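(* Let $G=(V\sqcup W,E)$ be a finite bipartite graph with color classes $V$ and $W$, and let $S\subseteq V$ be a non-expanding set of $G$, i.e. $0<|N_G(S)|\le |S|$ and no vertex of $S$ is isolated in $G$. Then $$\sum_{J\subseteq S}(-1)^{|J|}\,I_{G-J}(x)=0,$$ where the sum is over all subsets $J$ of $S$ (including $J=\emptyset$ and $J=S$), $G-J$ is the bipartite graph obtained from $G$ by deleting all vertices in $J$ and all edges incident to them, and $I_{G-J}(x)$ is the interior polynomial of $G-J$.
   Context: Graphs are finite and may be disconnected and may have isolated vertices. For a bipartite graph $G=(V\sqcup W,E)$ with color classes $V,W$ (every edge joins a vertex of $V$ to a vertex of $W$): Neighborhoods: for $v\in V$, $N_G(v)=\{w\in W: w \text{ is adjacent to } v\}$; for $S\subseteq V$, $N_G(S)=\bigcup_{v\in S}N_G(v)$. Non-expanding set: $S\subseteq V$ is non-expanding if $0<|N_G(S)|\le|S|$ and $S$ contains no isolated vertices of $G$. Root polytope: for $v\in V$, $w\in W$ let $\mathbf v,\mathbf w$ be the corresponding standard basis vectors of $\mathbb R^V\oplus\mathbb R^W$. The root polytope is the convex hull $Q_G=\operatorname{Conv}\{\mathbf v+\mathbf w : vw\in E\}$. Ehrhart polynomial and series: for a positive integer $s$, $\varepsilon_{Q_G}(s)=|(s\cdot Q_G)\cap(\mathbb Z^V\oplus\mathbb Z^W)|$, and $\operatorname{Ehr}_{Q_G}(x)=1+\sum_{s\ge1}\varepsilon_{Q_G}(s)x^s$ as a formal power series. If $G$ has no edges, $\operatorname{Ehr}_{Q_G}(x)=1$.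 Interior polynomial: $I_G(x)$ is defined by $$\frac{I_G(x)}{(1-x)^{|V|+|W|-1}}=\operatorname{Ehr}_{Q_G}(x).$$ For a vertex-deleted graph $G-J$ with $J\subseteq V$, the color classes are $V\setminus J$ and $W$ (vertices of $W$ that become isolated are kept), so the exponent is $|V|-|J|+|W|-1$. *)

theory Defs
  imports "HOL-Analysis.Analysis" "HOL-Computational_Algebra.Formal_Power_Series"
begin

text \<open>
  The two colour classes live in different types, so they are automatically disjoint, and
  an edge \<open>vw\<close> is the pair \<open>(v, w)\<close>. The types are finite but the colour classes may be
  proper subsets of them, so that vertices can be deleted without changing types.
\<close>

record ('v, 'w) bigraph =
  left :: "'v set"
  right :: "'w set"
  edges :: "('v \<times> 'w) set"

definition bipartite_graph :: "('v::finite, 'w::finite) bigraph \<Rightarrow> bool" where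
  "bipartite_graph G \<longleftrightarrow> edges G \<subseteq> left G \<times> right G"

definition delete_left :: "('v, 'w) bigraph \<Rightarrow> 'v set \<Rightarrow> ('v, 'w) bigraph" where
  "delete_left G J =
     \<lparr>left = left G - J, right = right G, edges = {(v, w) \<in> edges G. v \<notin> J}\<rparr>"

definition nbrs :: "('v, 'w) bigraph \<Rightarrow> 'v \<Rightarrow> 'w set" where
  "nbrs G v = {w \<in> right G. (v, w) \<in> edges G}"

definition nbrs_set :: "('v, 'w) bigraph \<Rightarrow> 'v set \<Rightarrow> 'w set" where
  "nbrs_set G S = (\<Union>v\<in>S. nbrs G v)"

definition isolated_left :: "('v, 'w) bigraph \<Rightarrow> 'v \<Rightarrow> bool" where
  "isolated_left G v \<longleftrightarrow> v \<in> left G \<and> nbrs G v = {}"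

definition non_expanding :: "('v, 'w) bigraph \<Rightarrow> 'v set \<Rightarrow> bool" where
  "non_expanding G S \<longleftrightarrow>
     S \<subseteq> left G \<and> 0 < card (nbrs_set G S) \<and> card (nbrs_set G S) \<le> card S \<and>
     (\<forall>v\<in>S. \<not> isolated_left G v)"

text \<open>
  The ambient space is \<open>\<real>\<^sup>'\<^sup>v \<oplus> \<real>\<^sup>'\<^sup>w\<close>, with one coordinate for every element of the two types.
  Coordinates outside the colour classes vanish on the polytope, so they do not affect the
  number of lattice points.
\<close>

definition root_polytope :: "('v::finite, 'w::finite) bigraph \<Rightarrow> ((real^'v) \<times> (real^'w)) set" where
  "root_polytope G = convex hull {(axis v 1, 0) + (0, axis w 1) | v w. (v, w) \<in> edges G}"

definition lattice_points :: "((real^'v::finite) \<times> (real^'w::finite)) set" where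
  "lattice_points = {p. (\<forall>v. fst p $ v \<in> \<int>) \<and> (\<forall>w. snd p $ w \<in> \<int>)}"

definition ehrhart :: "((real^'v::finite) \<times> (real^'w::finite)) set \<Rightarrow> nat \<Rightarrow> nat" where
  "ehrhart Q s = card ((\<lambda>p. real s *\<^sub>R p) ` Q \<inter> lattice_points)"

definition ehrhart_series :: "((real^'v::finite) \<times> (real^'w::finite)) set \<Rightarrow> rat fps" where
  "ehrhart_series Q = Abs_fps (\<lambda>s. if s = 0 then 1 else of_nat (ehrhart Q s))"

text \<open>
  The interior polynomial is kept as a formal power series: its defining equation
  (lemma \<open>interior_polynomial_eq\<close> below) is an identity of formal power series
  and determines it uniquely there. The truncated subtraction in the exponent
  only matters for the graph without vertices.
\<close>

definition interior_polynomial :: "('v::finite, 'w::finite) bigraph \<Rightarrow> rat fps" where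
  "interior_polynomial G =
     (1 - fps_X) ^ (card (left G) + card (right G) - 1) * ehrhart_series (root_polytope G)"

lemma one_minus_fps_X_power_nth_0: "fps_nth ((1 - fps_X :: rat fps) ^ n) 0 = 1"
  by (simp add: fps_power_zeroth)

lemma interior_polynomial_eq_iff:
  "I / (1 - fps_X) ^ (card (left G) + card (right G) - 1) = ehrhart_series (root_polytope G)
     \<longleftrightarrow> I = interior_polynomial G"
proof -
  define D where "D = (1 - fps_X :: rat fps) ^ (card (left G) + card (right G) - 1)"
  define e where "e = ehrhart_series (root_polytope G)"
  have D0: "fps_nth D 0 \<noteq> 0"
    unfolding D_def one_minus_fps_X_power_nth_0 by (rule one_neq_zero)
  then have nz: "D \<noteq> 0" by auto
  have inv: "inverse D * D = 1"
    by (rule inverse_mult_eq_1[OF D0])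
  have "I / D = e \<longleftrightarrow> I * inverse D = e"
    by (simp only: fps_divide_unit[OF D0])
  also have "\<dots> \<longleftrightarrow> (I * inverse D) * D = e * D"
    by (rule mult_right_cancel[OF nz, symmetric])
  also have "\<dots> \<longleftrightarrow> I = D * e"
    by (simp only: mult.assoc inv mult_1_right mult.commute[of e D])
  finally show ?thesis
    unfolding D_def e_def interior_polynomial_def .
qed

lemma interior_polynomial_eq:
  "interior_polynomial G / (1 - fps_X) ^ (card (left G) + card (right G) - 1)
     = ehrhart_series (root_polytope G)"
  by (rule interior_polynomial_eq_iff[THEN iffD2, OF refl])

lemma ehrhart_series_no_edges:
  "edges G = {} \<Longrightarrow> ehrhart_series (root_polytope G) = 1"
  by (rule fps_ext) (simp add: ehrhart_series_def root_polytope_def ehrhart_def)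

end

theory Submission
  imports Defs "HOL-Combinatorics.Multiset_Permutations"
begin

text \<open>
  For a vector \<open>a\<close> of natural numbers on the left vertices let \<open>\<rho>\<^sub>a(X)\<close> be the total weight of the
  vertices with a neighbour in \<open>X\<close>. The function \<open>\<rho>\<^sub>a\<close> is submodular, and by integer
  decomposition (\<open>base_points_add_hits\<close>) the lattice points of \<open>s \<cdot> Q\<^sub>G\<close> are the pairs \<open>(a, b)\<close> where
  \<open>a\<close> has sum \<open>s\<close> and vanishes on isolated vertices, and \<open>b\<close> is an integer point of the base
  polytope of \<open>\<rho>\<^sub>a\<close>. The lattice points for \<open>G - J\<close> are those with \<open>a\<close> vanishing on \<open>J\<close>. Let \<open>L(a)\<close>
  be the number of admissible \<open>b\<close>. Up to a common power of \<open>1 - x\<close>, the alternating sum of interior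
  polynomials is \<open>\<Sum>\<^sub>J (-1)\<^sup>|\<^sup>J\<^sup>| (1 - x)\<^sup>|\<^sup>S\<^sup>-\<^sup>J\<^sup>|\<close> times the Ehrhart series of \<open>G - J\<close>. Expanding
  the powers of \<open>1 - x\<close> over subsets \<open>T\<close> of \<open>S - J\<close> and collecting the terms with a given vector \<open>a\<close>
  leaves the product of \<open>\<Sum> (-1)\<^sup>|\<^sup>J\<^sup>|\<close> over \<open>J \<subseteq> S - supp a\<close> and \<open>\<Sum> (-1)\<^sup>|\<^sup>T\<^sup>| L(a - 1\<^sub>T)\<close> over
  \<open>T \<subseteq> S \<inter> supp a\<close>. The first factor vanishes unless \<open>S\<close> is contained in the support of \<open>a\<close>, and
  it remains to see that the mixed difference \<open>\<Sum> (-1)\<^sup>|\<^sup>T\<^sup>| L(a - 1\<^sub>T)\<close> over all \<open>T \<subseteq> S\<close> is zero.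

  Increasing \<open>a\<close> at \<open>v \<in> S\<close> adds to \<open>\<rho>\<^sub>a\<close> the function that tests whether \<open>X\<close> meets the neighbourhood
  of \<open>v\<close>; it depends only on the part of \<open>X\<close> in \<open>N(S)\<close>. Slicing the base polytopes at the coordinates
  outside \<open>N(S)\<close> therefore reduces the claim to base polytopes on a ground set of \<open>|N(S)| \<le> |S|\<close>
  elements (\<open>alternating_base_points_count_local\<close>). There Brion's formula (\<open>brion_base_points\<close>)
  writes the generating function of the integer points as a sum over the linear orders of the ground
  set, each term being the monomial of a vertex divided by \<open>|N(S)| - 1\<close> factors \<open>1 - z\<^sub>y / z\<^sub>x\<close>. The
  vertices depend additively on the submodular function, so the mixed difference multiplies each term
  by \<open>|S|\<close> factors \<open>1 - z\<^sup>c\<close>. Along the curve \<open>z\<^sub>x = t\<^sup>m\<^sup>(\<^sup>x\<^sup>)\<close> with distinct exponents \<open>m(x)\<close>, each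
  term thus has a zero of order at least \<open>|S|\<close> at \<open>t = 1\<close> against a pole of order \<open>|N(S)| - 1\<close>, and
  tends to \<open>0\<close> as \<open>t\<close> tends to \<open>1\<close> (\<open>alternating_base_points_count\<close>).
\<close>

section \<open>Submodular functions and their base polytopes\<close>

text \<open>
  Submodular integer set functions on the subsets of \<open>A\<close>, normalised by \<open>\<rho> {} = 0\<close>;
  monotonicity is not required.
\<close>

definition submodular_on :: "'a set \<Rightarrow> ('a set \<Rightarrow> int) \<Rightarrow> bool" where
  "submodular_on A \<rho> \<longleftrightarrow> \<rho> {} = 0 \<and>
     (\<forall>X Y. X \<subseteq> A \<longrightarrow> Y \<subseteq> A \<longrightarrow> \<rho> (X \<union> Y) + \<rho> (X \<inter> Y) \<le> \<rho> X + \<rho> Y)"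

text \<open>
  The integer points of the base polytope
  \<open>b(X) \<le> \<rho>(X)\<close> for \<open>X \<subseteq> A\<close>, \<open>b(A) = \<rho>(A)\<close>. Points are extended by \<open>0\<close> outside \<open>A\<close>, so that
  distinct functions are distinct points.
\<close>

definition base_points :: "'a set \<Rightarrow> ('a set \<Rightarrow> int) \<Rightarrow> ('a \<Rightarrow> int) set" where
  "base_points A \<rho> =
     {b. (\<forall>x. x \<notin> A \<longrightarrow> b x = 0) \<and> (\<forall>X\<subseteq>A. sum b X \<le> \<rho> X) \<and> sum b A = \<rho> A}"

text \<open>
  Fixing the coordinate \<open>u\<close> of a base polytope on \<open>insert u A\<close> at an attainable value \<open>k\<close> gives
  the base polytope of this function on \<open>A\<close>: it is the stronger of the two bounds for \<open>X\<close> and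
  \<open>insert u X\<close>.
\<close>

definition slice :: "('a set \<Rightarrow> int) \<Rightarrow> 'a \<Rightarrow> int \<Rightarrow> 'a set \<Rightarrow> int" where
  "slice \<rho> u k X = min (\<rho> X) (\<rho> (insert u X) - k)"

lemma submodular_onD:
  assumes "submodular_on A \<rho>" "X \<subseteq> A" "Y \<subseteq> A"
  shows "\<rho> (X \<union> Y) + \<rho> (X \<inter> Y) \<le> \<rho> X + \<rho> Y"
  using assms unfolding submodular_on_def by blast

lemma submodular_on_empty: "submodular_on A \<rho> \<Longrightarrow> \<rho> {} = 0"
  by (simp add: submodular_on_def)

lemma submodular_on_subset: "submodular_on A \<rho> \<Longrightarrow> B \<subseteq> A \<Longrightarrow> submodular_on B \<rho>"
  unfolding submodular_on_def by (meson subset_trans)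

lemma submodular_on_add:
  assumes "submodular_on A \<rho>" "submodular_on A \<sigma>"
  shows "submodular_on A (\<lambda>X. \<rho> X + \<sigma> X)"
  unfolding submodular_on_def
proof (intro conjI allI impI)
  fix X Y assume "X \<subseteq> A" "Y \<subseteq> A"
  then show "\<rho> (X \<union> Y) + \<sigma> (X \<union> Y) + (\<rho> (X \<inter> Y) + \<sigma> (X \<inter> Y)) \<le> \<rho> X + \<sigma> X + (\<rho> Y + \<sigma> Y)"
    using submodular_onD[OF assms(1), of X Y] submodular_onD[OF assms(2), of X Y] by linarith
qed (use assms in \<open>simp add: submodular_on_empty\<close>)

lemma submodular_on_sum:
  assumes "\<And>v. v \<in> T \<Longrightarrow> submodular_on A (h v)"
  shows "submodular_on A (\<lambda>X. \<Sum>v\<in>T. h v X)"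
  unfolding submodular_on_def
proof (intro conjI allI impI)
  show "(\<Sum>v\<in>T. h v {}) = 0"
    by (intro sum.neutral ballI submodular_on_empty[OF assms])
  fix X Y assume "X \<subseteq> A" "Y \<subseteq> A"
  then have "(\<Sum>v\<in>T. h v (X \<union> Y) + h v (X \<inter> Y)) \<le> (\<Sum>v\<in>T. h v X + h v Y)"
    by (intro sum_mono submodular_onD[OF assms])
  then show "(\<Sum>v\<in>T. h v (X \<union> Y)) + (\<Sum>v\<in>T. h v (X \<inter> Y)) \<le> (\<Sum>v\<in>T. h v X) + (\<Sum>v\<in>T. h v Y)"
    by (simp add: sum.distrib)
qed

lemma submodular_on_scale:
  assumes "submodular_on A \<rho>" "c \<ge> 0"
  shows "submodular_on A (\<lambda>X. c * \<rho> X)"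
  unfolding submodular_on_def
proof (intro conjI allI impI)
  fix X Y assume "X \<subseteq> A" "Y \<subseteq> A"
  then have "c * (\<rho> (X \<union> Y) + \<rho> (X \<inter> Y)) \<le> c * (\<rho> X + \<rho> Y)"
    using assms by (intro mult_left_mono submodular_onD)
  then show "c * \<rho> (X \<union> Y) + c * \<rho> (X \<inter> Y) \<le> c * \<rho> X + c * \<rho> Y"
    by (simp add: distrib_left)
qed (use assms in \<open>simp add: submodular_on_empty\<close>)

lemma submodular_on_diminishing:
  assumes "submodular_on (insert u A) \<rho>" "u \<notin> A" "X \<subseteq> Y" "Y \<subseteq> A"
  shows "\<rho> (insert u Y) - \<rho> Y \<le> \<rho> (insert u X) - \<rho> X"
proof -
  have "\<rho> (insert u X \<union> Y) + \<rho> (insert u X \<inter> Y) \<le> \<rho> (insert u X) + \<rho> Y"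
    using assms by (intro submodular_onD[OF assms(1)]) auto
  moreover have "insert u X \<union> Y = insert u Y" "insert u X \<inter> Y = X"
    using assms by auto
  ultimately show ?thesis by simp
qed

lemma submodular_on_slice:
  assumes sm: "submodular_on (insert u A) \<rho>" and u: "u \<notin> A" and k: "k \<le> \<rho> {u}"
  shows "submodular_on A (slice \<rho> u k)"
  unfolding submodular_on_def
proof (intro conjI allI impI)
  show "slice \<rho> u k {} = 0"
    using k submodular_on_empty[OF sm] by (simp add: slice_def)
  fix X Y assume X: "X \<subseteq> A" and Y: "Y \<subseteq> A"
  have 1: "\<rho> (X \<union> Y) + \<rho> (X \<inter> Y) \<le> \<rho> X + \<rho> Y"
    using X Y by (intro submodular_onD[OF sm]) auto
  have 2: "\<rho> (insert u (X \<union> Y)) + \<rho> (insert u (X \<inter> Y)) \<le> \<rho> (insert u X) + \<rho> (insert u Y)"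
    using X Y submodular_onD[OF sm, of "insert u X" "insert u Y"] by auto
  have 3: "\<rho> (insert u (X \<union> Y)) + \<rho> (X \<inter> Y) \<le> \<rho> (insert u X) + \<rho> Y" if "X \<subseteq> A" "Y \<subseteq> A" for X Y
  proof -
    have "insert u X \<inter> Y = X \<inter> Y" using that u by auto
    then show ?thesis using that submodular_onD[OF sm, of "insert u X" Y] by auto
  qed
  show "slice \<rho> u k (X \<union> Y) + slice \<rho> u k (X \<inter> Y) \<le> slice \<rho> u k X + slice \<rho> u k Y"
    using 1 2 3[OF X Y] 3[OF Y X] unfolding slice_def
    by (simp add: Un_commute Int_commute min_def)
qed

lemma finite_base_points:
  assumes "finite A"
  shows "finite (base_points A \<rho>)"
proof (rule finite_subset)
  let ?B = "\<Union>x\<in>A. {\<rho> A - \<rho> (A - {x})..\<rho> {x}}"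
  show "finite {b. \<forall>x. (x \<in> A \<longrightarrow> b x \<in> ?B) \<and> (x \<notin> A \<longrightarrow> b x = 0)}"
    using assms by (intro finite_set_of_finite_funs) auto
  show "base_points A \<rho> \<subseteq> {b. \<forall>x. (x \<in> A \<longrightarrow> b x \<in> ?B) \<and> (x \<notin> A \<longrightarrow> b x = 0)}"
  proof (intro subsetI CollectI allI conjI impI)
    fix b x assume b: "b \<in> base_points A \<rho>"
    show "b x = 0" if "x \<notin> A" using b that by (simp add: base_points_def)
    assume x: "x \<in> A"
    have le: "sum b X \<le> \<rho> X" if "X \<subseteq> A" for X
      using b that by (simp add: base_points_def)
    have "sum b A = b x + sum b (A - {x})"
      using assms x by (simp add: sum.remove)
    moreover have "sum b A = \<rho> A" using b by (simp add: base_points_def)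
    ultimately have "\<rho> A - \<rho> (A - {x}) \<le> b x" "b x \<le> \<rho> {x}"
      using le[of "A - {x}"] le[of "{x}"] x by auto
    then show "b x \<in> ?B" using x by auto
  qed
qed

text \<open>
  A base polytope is the disjoint union of its slices. The bounds on \<open>k\<close> are exactly those for
  which \<open>slice \<rho> u k\<close> vanishes at \<open>{}\<close> and has the value \<open>\<rho> (insert u A) - k\<close> at \<open>A\<close>.
\<close>

lemma sum_base_points_insert:
  fixes f :: "('a \<Rightarrow> int) \<Rightarrow> 'b::comm_monoid_add"
  assumes A: "finite A" and u: "u \<notin> A" and \<rho>0: "\<rho> {} = 0"
  shows "sum f (base_points (insert u A) \<rho>) =
    (\<Sum>k = \<rho> (insert u A) - \<rho> A..\<rho> {u}. \<Sum>b\<in>base_points A (slice \<rho> u k). f (b(u := k)))"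
proof -
  let ?K = "{\<rho> (insert u A) - \<rho> A..\<rho> {u}}"
  have upd: "sum (b(u := k)) X = sum b X" if "X \<subseteq> A" for b :: "'a \<Rightarrow> int" and k X
    using that u by (intro sum.cong) auto
  have ins: "sum b (insert u X) = b u + sum b X" if "X \<subseteq> A" for b :: "'a \<Rightarrow> int" and X
    using that u finite_subset[OF that A] by (subst sum.insert) auto
  have fwd: "b u \<in> ?K \<and> b(u := 0) \<in> base_points A (slice \<rho> u (b u))"
    if b: "b \<in> base_points (insert u A) \<rho>" for b
  proof -
    have le: "sum b X \<le> \<rho> X" if "X \<subseteq> insert u A" for X
      using b that by (simp add: base_points_def)
    have eq: "b u + sum b A = \<rho> (insert u A)"
      using b ins[of A b] by (simp add: base_points_def)
    have 1: "sum b X \<le> \<rho> X" "b u + sum b X \<le> \<rho> (insert u X)" if "X \<subseteq> A" for X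
      using le[of X] le[of "insert u X"] ins[of X b] that by auto
    have "sum (b(u := 0)) X \<le> slice \<rho> u (b u) X" if "X \<subseteq> A" for X
      using 1[OF that] upd[OF that, of b 0] by (simp add: slice_def)
    moreover have "sum (b(u := 0)) A = slice \<rho> u (b u) A"
      using 1(1)[of A] eq upd[of A b 0] by (simp add: slice_def)
    moreover have "(b(u := 0)) x = 0" if "x \<notin> A" for x
      using that b by (simp add: base_points_def)
    ultimately show ?thesis
      using eq 1(1)[of A] le[of "{u}"] by (simp add: base_points_def)
  qed
  have bwd: "b(u := k) \<in> base_points (insert u A) \<rho> \<and> b(u := k, u := 0) = b"
    if k: "k \<in> ?K" and b: "b \<in> base_points A (slice \<rho> u k)" for k b
  proof -
    have le: "sum b X \<le> slice \<rho> u k X" if "X \<subseteq> A" for X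
      using b that by (simp add: base_points_def)
    have eq: "sum b A = slice \<rho> u k A" and z: "\<And>x. x \<notin> A \<Longrightarrow> b x = 0"
      using b by (auto simp: base_points_def)
    have "sum (b(u := k)) X \<le> \<rho> X" if "X \<subseteq> insert u A" for X
    proof (cases "u \<in> X")
      case True
      have X: "insert u (X - {u}) = X" and sub: "X - {u} \<subseteq> A" using True that by auto
      show ?thesis
        using ins[OF sub, of "b(u := k)"] le[OF sub] upd[OF sub, of b k] X
        by (simp add: slice_def)
    next
      case False
      then have "X \<subseteq> A" using that by auto
      then show ?thesis using le[of X] upd[of X b k] by (simp add: slice_def)
    qed
    moreover have "sum (b(u := k)) (insert u A) = \<rho> (insert u A)"
      using ins[of A "b(u := k)"] upd[of A b k] eq k by (simp add: slice_def)
    ultimately show ?thesis using z u by (auto simp: base_points_def)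
  qed
  have "sum f (base_points (insert u A) \<rho>) =
    (\<Sum>(k, b)\<in>Sigma ?K (\<lambda>k. base_points A (slice \<rho> u k)). f (b(u := k)))"
  proof (rule sum.reindex_bij_witness[where j = "\<lambda>b. (b u, b(u := 0))"
            and i = "\<lambda>(k, b). b(u := k)"])
    fix b assume "b \<in> base_points (insert u A) \<rho>"
    then show "(b u, b(u := 0)) \<in> Sigma ?K (\<lambda>k. base_points A (slice \<rho> u k))"
      using fwd by blast
  next
    fix kb assume "kb \<in> Sigma ?K (\<lambda>k. base_points A (slice \<rho> u k))"
    then obtain k b where "kb = (k, b)" "k \<in> ?K" "b \<in> base_points A (slice \<rho> u k)"
      by blast
    then show "(\<lambda>(k, b). b(u := k)) kb \<in> base_points (insert u A) \<rho>"
      "((\<lambda>(k, b). b(u := k)) kb u, ((\<lambda>(k, b). b(u := k)) kb)(u := 0)) = kb"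
      using bwd by auto
  qed (simp_all add: fun_upd_idem)
  also have "\<dots> = (\<Sum>k\<in>?K. \<Sum>b\<in>base_points A (slice \<rho> u k). f (b(u := k)))"
    by (rule sum.Sigma[symmetric]) (simp_all add: A finite_base_points)
  finally show ?thesis .
qed

section \<open>Brion's formula for base polytopes\<close>

text \<open>
  A linear order \<open>x\<^sub>1, \<dots>, x\<^sub>n\<close> of the ground set determines the vertex of the base polytope with
  coordinates \<open>\<rho> {x\<^sub>1, \<dots>, x\<^sub>i} - \<rho> {x\<^sub>1, \<dots>, x\<^sub>i\<^sub>-\<^sub>1}\<close>. For \<open>P = {}\<close> the following is the
  monomial of that vertex at the point \<open>z\<close>; the set \<open>P\<close> collects the elements that
  precede the list.
\<close>

fun vertex_monomial :: "('a \<Rightarrow> real) \<Rightarrow> ('a set \<Rightarrow> int) \<Rightarrow> 'a set \<Rightarrow> 'a list \<Rightarrow> real" where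
  "vertex_monomial z \<rho> P [] = 1"
| "vertex_monomial z \<rho> P (x # xs) =
     z x powi (\<rho> (insert x P) - \<rho> P) * vertex_monomial z \<rho> (insert x P) xs"

text \<open>
  The denominator \<open>\<Prod>\<^sub>i (1 - z\<^sub>i\<^sub>+\<^sub>1 / z\<^sub>i)\<close> of the generating function of the cone spanned by the
  directions from the \<open>i\<close>-th to the \<open>(i+1)\<close>-st unit vector.
\<close>

fun cone_denominator :: "('a \<Rightarrow> real) \<Rightarrow> 'a list \<Rightarrow> real" where
  "cone_denominator z (x # y # xs) = (1 - z y / z x) * cone_denominator z (y # xs)"
| "cone_denominator z xs = 1"

definition insert_at :: "nat \<Rightarrow> 'a \<Rightarrow> 'a list \<Rightarrow> 'a list" where
  "insert_at i u xs = take i xs @ u # drop i xs"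

lemma insert_at_simps [simp]:
  "insert_at 0 u xs = u # xs"
  "insert_at (Suc i) u (x # xs) = x # insert_at i u xs"
  by (simp_all add: insert_at_def)

lemma cone_denominator_nonzero:
  assumes "distinct xs" "inj_on z (set xs)" "\<And>x. x \<in> set xs \<Longrightarrow> z x \<noteq> 0"
  shows "cone_denominator z xs \<noteq> 0"
  using assms
proof (induction z xs rule: cone_denominator.induct)
  case (1 z x y xs)
  then have "z x \<noteq> z y" "z x \<noteq> 0" by auto
  moreover have "cone_denominator z (y # xs) \<noteq> 0" using 1 by auto
  ultimately show ?case by simp
qed auto

lemma vertex_monomial_shift:
  assumes "\<And>X. P \<subseteq> X \<Longrightarrow> X \<subseteq> P \<union> set xs \<Longrightarrow> \<rho>' X = \<rho> (insert u X) - k"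
  shows "vertex_monomial z \<rho>' P xs = vertex_monomial z \<rho> (insert u P) xs"
  using assms
proof (induction xs arbitrary: P)
  case (Cons x xs)
  have "vertex_monomial z \<rho>' (insert x P) xs = vertex_monomial z \<rho> (insert u (insert x P)) xs"
    by (rule Cons.IH) (use Cons.prems in auto)
  moreover have "\<rho>' (insert x P) = \<rho> (insert u (insert x P)) - k" "\<rho>' P = \<rho> (insert u P) - k"
    using Cons.prems by auto
  ultimately show ?case by (simp add: insert_commute)
qed simp

lemma geometric_sum_powi:
  fixes r :: real
  assumes "r \<noteq> 0" "r \<noteq> 1" "d' \<le> d"
  shows "(\<Sum>k = d' + 1..d. r powi k) = r / (1 - r) * (r powi d' - r powi d)"
  using assms(3)
proof (induction d rule: int_ge_induct)
  case (step i)
  have "{d' + 1..i + 1} = insert (i + 1) {d' + 1..i}" using step.hyps by auto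
  then have "(\<Sum>k = d' + 1..i + 1. r powi k) = r powi i * r + r / (1 - r) * (r powi d' - r powi i)"
    using step.IH assms(1) by (simp add: power_int_add)
  also have "\<dots> = r / (1 - r) * (r powi d' - r powi i * r)"
    using assms(2) by (simp add: divide_simps) (simp add: algebra_simps)
  finally show ?case using assms(1) by (simp add: power_int_add)
qed simp

text \<open>
  The heart of Brion's formula. For a fixed order \<open>xs\<close> of the other elements, the
  corresponding vertex of the slice at height \<open>k\<close> runs, as \<open>k\<close> grows, along an edge path of the
  whole base polytope. Its break points are the vertices for the orders obtained by inserting
  \<open>u\<close> into \<open>xs\<close>, from the last position to the first, and each edge contributes a geometric sum.
\<close>

lemma slice_vertex_sum:
  assumes "submodular_on (insert u (P \<union> set xs)) \<rho>" "distinct (u # xs)" "set xs \<inter> P = {}" "u \<notin> P"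
    "inj_on z (set (u # xs))" "\<And>x. x \<in> set (u # xs) \<Longrightarrow> z x \<noteq> 0"
  shows "(\<Sum>k = \<rho> (insert u (P \<union> set xs)) - \<rho> (P \<union> set xs)..\<rho> (insert u P) - \<rho> P.
            z u powi k * vertex_monomial z (slice \<rho> u k) P xs) =
         (\<Sum>i\<le>length xs. vertex_monomial z \<rho> P (insert_at i u xs) *
            (cone_denominator z xs / cone_denominator z (insert_at i u xs)))"
  using assms
proof (induction xs arbitrary: P)
  case Nil
  then show ?case by simp
next
  case (Cons x xs)
  define P' where "P' = insert x P"
  define A where "A = P \<union> set (x # xs)"
  define d where "d X = \<rho> (insert u X) - \<rho> X" for X
  define r where "r = z u / z x"
  have A: "A = P' \<union> set xs" by (auto simp: A_def P'_def)
  have sm: "submodular_on (insert u A) \<rho>" using Cons.prems(1) by (simp add: A_def)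
  have uA: "u \<notin> A" using Cons.prems by (auto simp: A_def)
  have mono: "d Y \<le> d X" if "X \<subseteq> Y" "Y \<subseteq> A" for X Y
    unfolding d_def by (rule submodular_on_diminishing[OF sm uA that])
  have sub: "P \<subseteq> P'" "P' \<subseteq> A" by (auto simp: A_def P'_def)
  have ord: "d A \<le> d P'" "d P' \<le> d P" using mono sub by auto
  have nz: "z x \<noteq> 0" "z u \<noteq> 0" "z u \<noteq> z x" using Cons.prems by auto
  then have r: "r \<noteq> 0" "r \<noteq> 1" by (auto simp: r_def)
  let ?f = "\<lambda>k. z u powi k * vertex_monomial z (slice \<rho> u k) P (x # xs)"
  \<comment> \<open>Up to \<open>d P'\<close> the coordinate at \<open>x\<close> of the vertex of the slice does not depend on \<open>k\<close>. Above
    it this is the only coordinate in \<open>xs\<close> and \<open>x\<close> that does: \<open>k\<close> moves along one edge.\<close>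
  have low: "?f k = z x powi (\<rho> P' - \<rho> P) * (z u powi k * vertex_monomial z (slice \<rho> u k) P' xs)"
    if "k \<in> {d A..d P'}" for k
  proof -
    have "slice \<rho> u k P' = \<rho> P'" "slice \<rho> u k P = \<rho> P"
      using that ord by (auto simp: slice_def d_def)
    then show ?thesis by (simp add: P'_def)
  qed
  have high: "?f k = z x powi (\<rho> (insert u P') - \<rho> P) * vertex_monomial z \<rho> (insert u P') xs * r powi k"
    if k: "k \<in> {d P' + 1..d P}" for k
  proof -
    have "vertex_monomial z (slice \<rho> u k) P' xs = vertex_monomial z \<rho> (insert u P') xs"
    proof (rule vertex_monomial_shift)
      fix X assume "P' \<subseteq> X" "X \<subseteq> P' \<union> set xs"
      then have "d X \<le> d P'" using mono A by auto
      then show "slice \<rho> u k X = \<rho> (insert u X) - k"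
        using k by (auto simp: slice_def d_def)
    qed
    moreover have "slice \<rho> u k P' = \<rho> (insert u P') - k" "slice \<rho> u k P = \<rho> P"
      using k by (auto simp: slice_def d_def)
    moreover have "\<rho> (insert u P') - k - \<rho> P = \<rho> (insert u P') - \<rho> P - k" by simp
    ultimately have "?f k = z u powi k * (z x powi (\<rho> (insert u P') - \<rho> P - k) *
        vertex_monomial z \<rho> (insert u P') xs)"
      by (simp only: vertex_monomial.simps P'_def[symmetric])
    also have "z x powi (\<rho> (insert u P') - \<rho> P - k) = z x powi (\<rho> (insert u P') - \<rho> P) / z x powi k"
      using nz by (simp add: power_int_diff)
    finally show ?thesis by (simp add: r_def power_int_divide_distrib)
  qed
  have split: "{d A..d P} = {d A..d P'} \<union> {d P' + 1..d P}" using ord by auto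
  define R where "R i = vertex_monomial z \<rho> P' (insert_at i u xs) *
            (cone_denominator z xs / cone_denominator z (insert_at i u xs))" for i
  have IH: "(\<Sum>k = d A..d P'. z u powi k * vertex_monomial z (slice \<rho> u k) P' xs) =
         (\<Sum>i\<le>length xs. R i)"
    unfolding d_def A R_def by (rule Cons.IH) (use Cons.prems A A_def P'_def in auto)
  define M where "M l = vertex_monomial z \<rho> P l" for l
  define Q where "Q i = M (insert_at i u (x # xs)) *
            (cone_denominator z (x # xs) / cone_denominator z (insert_at i u (x # xs)))" for i
  define c where "c = z x powi (\<rho> P' - \<rho> P)"
  have geo: "z x powi (\<rho> (insert u P') - \<rho> P) * vertex_monomial z \<rho> (insert u P') xs *
      (r / (1 - r) * (r powi d P' - r powi d P)) = r / (1 - r) * (M (x # u # xs) - M (u # x # xs))"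
  proof -
    have e1: "M (x # u # xs) = z x powi (\<rho> (insert u P') - \<rho> P) * vertex_monomial z \<rho> (insert u P') xs * r powi d P'"
    proof -
      have "z x powi (\<rho> P' - \<rho> P) = z x powi (\<rho> (insert u P') - \<rho> P) / z x powi d P'"
        using nz by (simp add: power_int_diff[symmetric] d_def)
      then show ?thesis
        by (simp add: M_def P'_def[symmetric] d_def[symmetric] r_def power_int_divide_distrib)
    qed
    have e2: "M (u # x # xs) = z x powi (\<rho> (insert u P') - \<rho> P) * vertex_monomial z \<rho> (insert u P') xs * r powi d P"
    proof -
      have "z x powi (\<rho> (insert u P') - \<rho> (insert u P)) = z x powi (\<rho> (insert u P') - \<rho> P) / z x powi d P"
        using nz by (simp add: power_int_diff[symmetric] d_def)
      then show ?thesis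
        by (simp add: M_def P'_def insert_commute[of x u] d_def[symmetric] r_def power_int_divide_distrib)
    qed
    show ?thesis by (simp add: e1 e2 algebra_simps)
  qed
  have "(\<Sum>k = d A..d P. ?f k) = (\<Sum>k = d A..d P'. ?f k) + (\<Sum>k = d P' + 1..d P. ?f k)"
    unfolding split by (rule sum.union_disjoint) auto
  also have "(\<Sum>k = d A..d P'. ?f k) = c * (\<Sum>i\<le>length xs. R i)"
    unfolding IH[symmetric] sum_distrib_left c_def using low by (intro sum.cong) auto
  also have "(\<Sum>k = d P' + 1..d P. ?f k) = z x powi (\<rho> (insert u P') - \<rho> P) *
      vertex_monomial z \<rho> (insert u P') xs * (\<Sum>k = d P' + 1..d P. r powi k)"
    unfolding sum_distrib_left using high by (intro sum.cong) auto
  also have "\<dots> = r / (1 - r) * (M (x # u # xs) - M (u # x # xs))"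
    unfolding geometric_sum_powi[OF r ord(2)] geo ..
  finally have lhs: "(\<Sum>k = d A..d P. ?f k) =
      c * (\<Sum>i\<le>length xs. R i) + r / (1 - r) * (M (x # u # xs) - M (u # x # xs))" .
  have MR: "M (x # l) = c * vertex_monomial z \<rho> P' l" for l by (simp add: M_def c_def P'_def)
  \<comment> \<open>The first two insertion positions absorb the two ends of the edge in direction \<open>x\<close>; the
    others come unchanged from the shorter list.\<close>
  have Q0: "Q 0 = - (r / (1 - r)) * M (u # x # xs)"
  proof -
    have D: "cone_denominator z (x # xs) \<noteq> 0"
      using Cons.prems by (intro cone_denominator_nonzero) (auto simp: inj_on_def)
    then show ?thesis using nz by (simp add: Q_def r_def divide_simps) (simp add: field_simps)
  qed
  have Q1: "Q (Suc 0) = c * R 0 + r / (1 - r) * M (x # u # xs)"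
  proof (cases xs)
    case Nil
    then show ?thesis using nz
      by (simp add: Q_def R_def MR r_def divide_simps) (simp add: algebra_simps)
  next
    case (Cons y ys)
    have D: "cone_denominator z (y # ys) \<noteq> 0"
      using Cons Cons.prems by (intro cone_denominator_nonzero) (auto simp: inj_on_def)
    have "z y \<noteq> z u" using Cons Cons.prems by auto
    then have "(1 - z y / z x) / ((1 - z u / z x) * (1 - z y / z u)) = 1 / (1 - z y / z u) + r / (1 - r)"
      using nz by (simp add: r_def divide_simps) (simp add: algebra_simps)
    then show ?thesis using D 
      by (simp add: Q_def R_def MR Cons) (simp add: algebra_simps)
  qed
  have Q2: "Q (Suc (Suc i)) = c * R (Suc i)" if i: "Suc i \<le> length xs" for i
  proof -
    obtain y ys where xs: "xs = y # ys" using i by (cases xs) auto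
    have "1 - z y / z x \<noteq> 0" using Cons.prems xs nz by auto
    then have "cone_denominator z (x # y # ys) / cone_denominator z (x # y # l) =
        cone_denominator z (y # ys) / cone_denominator z (y # l)" for l
      by (simp only: cone_denominator.simps mult_divide_mult_cancel_left not_False_eq_True)
    then show ?thesis by (simp add: Q_def R_def MR xs del: cone_denominator.simps)
  qed
  have "(\<Sum>i\<le>length (x # xs). Q i) = Q 0 + (\<Sum>i\<le>length xs. Q (Suc i))"
    unfolding length_Cons by (rule sum.atMost_Suc_shift)
  also have "(\<Sum>i\<le>length xs. Q (Suc i)) = Q (Suc 0) + (\<Sum>i<length xs. Q (Suc (Suc i)))"
    by (simp add: sum.atMost_shift)
  also have "(\<Sum>i<length xs. Q (Suc (Suc i))) = (\<Sum>i<length xs. c * R (Suc i))"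
    by (intro sum.cong) (auto simp: Q2)
  also have "Q 0 + (Q (Suc 0) + \<dots>) = c * (R 0 + (\<Sum>i<length xs. R (Suc i))) +
      r / (1 - r) * (M (x # u # xs) - M (u # x # xs))"
    by (simp add: Q0 Q1 sum_distrib_left algebra_simps)
  also have "R 0 + (\<Sum>i<length xs. R (Suc i)) = (\<Sum>i\<le>length xs. R i)"
    by (simp add: sum.atMost_shift)
  finally have "(\<Sum>i\<le>length (x # xs). Q i) = (\<Sum>k = d A..d P. ?f k)"
    unfolding lhs .
  then show ?case unfolding Q_def M_def d_def A_def by (rule sym)
qed

lemma sum_permutations_insert:
  assumes "finite A" "u \<notin> A"
  shows "sum f (permutations_of_set (insert u A)) =
    (\<Sum>xs\<in>permutations_of_set A. \<Sum>i\<le>length xs. f (insert_at i u xs))"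
proof -
  have "sum f (permutations_of_set (insert u A)) =
    (\<Sum>(xs, i)\<in>Sigma (permutations_of_set A) (\<lambda>xs. {..length xs}). f (insert_at i u xs))"
  proof (rule sum.reindex_bij_witness[where i = "\<lambda>(xs, i). insert_at i u xs"
        and j = "\<lambda>ys. (remove1 u ys, length (takeWhile (\<lambda>y. y \<noteq> u) ys))"])
    fix ys assume ys: "ys \<in> permutations_of_set (insert u A)"
    then obtain as bs where split: "ys = as @ u # bs" "u \<notin> set as" "u \<notin> set bs"
      by (metis distinct.simps(2) distinct_append in_set_conv_decomp_first insertI1
          permutations_of_setD)
    have eq: "remove1 u ys = as @ bs" "takeWhile (\<lambda>y. y \<noteq> u) ys = as"
      using split by (auto simp: remove1_append takeWhile_tail)
    show "(\<lambda>(xs, i). insert_at i u xs) (remove1 u ys, length (takeWhile (\<lambda>y. y \<noteq> u) ys)) = ys"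
      by (simp only: eq prod.case insert_at_def) (simp add: split(1))
    show "(remove1 u ys, length (takeWhile (\<lambda>y. y \<noteq> u) ys)) \<in>
        Sigma (permutations_of_set A) (\<lambda>xs. {..length xs})"
    proof -
      have "set ys = insert u A" "distinct ys" using ys by (auto dest: permutations_of_setD)
      then have "as @ bs \<in> permutations_of_set A"
        using split assms by (auto simp: permutations_of_set_def)
      then show ?thesis by (simp only: eq) simp
    qed
    show "(\<lambda>(xs, i). f (insert_at i u xs)) (remove1 u ys, length (takeWhile (\<lambda>y. y \<noteq> u) ys)) = f ys"
      by (simp only: eq prod.case insert_at_def) (simp add: split(1))
  next
    fix p assume "p \<in> Sigma (permutations_of_set A) (\<lambda>xs. {..length xs})"
    then obtain xs i where p: "p = (xs, i)" and xs: "xs \<in> permutations_of_set A" and i: "i \<le> length xs"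
      by auto
    have set: "set (take i xs) \<union> set (drop i xs) = A" and dist: "distinct xs" "set (take i xs) \<inter> set (drop i xs) = {}"
      using xs by (metis append_take_drop_id permutations_of_setD(1) set_append)
        (use xs set_take_disj_set_drop_if_distinct[of xs i i] in \<open>auto dest: permutations_of_setD\<close>)
    have u: "u \<notin> set (take i xs)" "u \<notin> set (drop i xs)" using set assms by auto
    show "(\<lambda>(xs, i). insert_at i u xs) p \<in> permutations_of_set (insert u A)"
      using u set dist by (auto simp: p insert_at_def permutations_of_set_def)
    show "(remove1 u ((\<lambda>(xs, i). insert_at i u xs) p),
        length (takeWhile (\<lambda>y. y \<noteq> u) ((\<lambda>(xs, i). insert_at i u xs) p))) = p"
    proof -
      have "takeWhile (\<lambda>y. y \<noteq> u) (take i xs @ u # drop i xs) = take i xs"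
        using u by (subst takeWhile_append2) auto
      then show ?thesis using u i by (simp add: p insert_at_def remove1_append)
    qed
  qed
  also have "\<dots> = (\<Sum>xs\<in>permutations_of_set A. \<Sum>i\<le>length xs. f (insert_at i u xs))"
    by (rule sum.Sigma[symmetric]) auto
  finally show ?thesis .
qed

theorem brion_base_points:
  fixes z :: "'a \<Rightarrow> real"
  assumes "finite A" "submodular_on A \<rho>" "inj_on z A" "\<And>x. x \<in> A \<Longrightarrow> z x \<noteq> 0"
  shows "(\<Sum>b\<in>base_points A \<rho>. \<Prod>x\<in>A. z x powi b x) =
    (\<Sum>xs\<in>permutations_of_set A. vertex_monomial z \<rho> {} xs / cone_denominator z xs)"
  using assms
proof (induction A arbitrary: \<rho>)
  case empty
  have "base_points {} \<rho> = {\<lambda>_. 0}"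
    using submodular_on_empty[OF empty(1)] by (auto simp: base_points_def)
  then show ?case by simp
next
  case (insert u A)
  note sm = insert.prems(1)
  have \<rho>0: "\<rho> {} = 0" by (rule submodular_on_empty[OF sm])
  let ?K = "{\<rho> (insert u A) - \<rho> A..\<rho> {u}}"
  have "(\<Sum>b\<in>base_points (insert u A) \<rho>. \<Prod>x\<in>insert u A. z x powi b x) =
    (\<Sum>k\<in>?K. \<Sum>b\<in>base_points A (slice \<rho> u k). \<Prod>x\<in>insert u A. z x powi (b(u := k)) x)"
    by (rule sum_base_points_insert) (use insert \<rho>0 in auto)
  also have "\<dots> = (\<Sum>k\<in>?K. z u powi k * (\<Sum>b\<in>base_points A (slice \<rho> u k). \<Prod>x\<in>A. z x powi b x))"
  proof -
    have "(\<Prod>x\<in>A. z x powi (b(u := k)) x) = (\<Prod>x\<in>A. z x powi b x)" for b k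
      using insert.hyps by (intro prod.cong) auto
    then show ?thesis using insert.hyps by (simp add: sum_distrib_left del: fun_upd_apply) simp
  qed
  also have "\<dots> = (\<Sum>k\<in>?K. z u powi k *
      (\<Sum>xs\<in>permutations_of_set A. vertex_monomial z (slice \<rho> u k) {} xs / cone_denominator z xs))"
  proof (intro sum.cong refl arg_cong[where f = "\<lambda>t. _ * t"] insert.IH)
    fix k assume "k \<in> ?K"
    then show "submodular_on A (slice \<rho> u k)"
      by (intro submodular_on_slice[OF sm insert.hyps(2)]) auto
  qed (use insert.prems in \<open>auto simp: inj_on_def\<close>)
  also have "\<dots> = (\<Sum>xs\<in>permutations_of_set A.
      (\<Sum>k\<in>?K. z u powi k * vertex_monomial z (slice \<rho> u k) {} xs) / cone_denominator z xs)"
    unfolding sum_distrib_left sum_divide_distrib by (subst sum.swap) simp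
  also have "\<dots> = (\<Sum>xs\<in>permutations_of_set A. \<Sum>i\<le>length xs.
      vertex_monomial z \<rho> {} (insert_at i u xs) / cone_denominator z (insert_at i u xs))"
  proof (rule sum.cong[OF refl])
    fix xs assume xs: "xs \<in> permutations_of_set A"
    then have A: "set xs = A" "distinct xs" by (auto dest: permutations_of_setD)
    have "cone_denominator z xs \<noteq> 0"
      using A insert.prems by (intro cone_denominator_nonzero) (auto simp: inj_on_def)
    moreover have "(\<Sum>k\<in>?K. z u powi k * vertex_monomial z (slice \<rho> u k) {} xs) =
      (\<Sum>i\<le>length xs. vertex_monomial z \<rho> {} (insert_at i u xs) *
            (cone_denominator z xs / cone_denominator z (insert_at i u xs)))"
      using slice_vertex_sum[of u "{}" xs \<rho> z] insert A \<rho>0 by simp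
    ultimately show "(\<Sum>k\<in>?K. z u powi k * vertex_monomial z (slice \<rho> u k) {} xs) / cone_denominator z xs =
      (\<Sum>i\<le>length xs. vertex_monomial z \<rho> {} (insert_at i u xs) / cone_denominator z (insert_at i u xs))"
      by (simp add: sum_divide_distrib)
  qed
  also have "\<dots> = (\<Sum>xs\<in>permutations_of_set (insert u A).
      vertex_monomial z \<rho> {} xs / cone_denominator z xs)"
    by (rule sum_permutations_insert[symmetric]) (use insert in auto)
  finally show ?case .
qed

section \<open>Mixed differences of the number of integer points\<close>

text \<open>
  The vertices depend additively on the submodular function, so a mixed difference
  multiplies each term of Brion's formula by factors \<open>1 - z\<^sup>c\<close>, one for each direction.
\<close>

lemma vertex_monomial_add:
  assumes "\<And>x. x \<in> set xs \<Longrightarrow> z x \<noteq> 0"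
  shows "vertex_monomial z (\<lambda>X. \<rho> X + \<sigma> X) P xs = vertex_monomial z \<rho> P xs * vertex_monomial z \<sigma> P xs"
  using assms by (induction xs arbitrary: P) (auto simp: power_int_add algebra_simps diff_add_eq
      power_int_diff field_simps)

lemma vertex_monomial_zero: "vertex_monomial z (\<lambda>X. 0) P xs = 1"
  by (induction xs arbitrary: P) auto

lemma vertex_monomial_sum:
  assumes "\<And>x. x \<in> set xs \<Longrightarrow> z x \<noteq> 0" "finite T"
  shows "vertex_monomial z (\<lambda>X. \<Sum>v\<in>T. h v X) P xs = (\<Prod>v\<in>T. vertex_monomial z (h v) P xs)"
  using assms(2) by (induction T) (simp_all add: vertex_monomial_zero vertex_monomial_add assms(1))

lemma prod_one_minus_expand:
  fixes y :: "'b \<Rightarrow> 'c::comm_ring_1"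
  assumes "finite S"
  shows "(\<Prod>v\<in>S. 1 - y v) = (\<Sum>T\<in>Pow S. (- 1) ^ card T * (\<Prod>v\<in>T. y v))"
  using prod_add[OF assms, of "\<lambda>v. - y v" "\<lambda>_. 1"] by (simp add: prod_uminus)

lemma vertex_monomial_power:
  obtains e where "\<And>t::real. t > 0 \<Longrightarrow> vertex_monomial (\<lambda>x. t powi m x) \<rho> P xs = t powi e"
proof -
  have "\<exists>e. \<forall>t::real. t > 0 \<longrightarrow> vertex_monomial (\<lambda>x. t powi m x) \<rho> P xs = t powi e"
  proof (induction xs arbitrary: P)
    case Nil
    then show ?case by (intro exI[of _ 0]) simp
  next
    case (Cons x xs)
    then obtain e where "\<forall>t::real. t > 0 \<longrightarrow> vertex_monomial (\<lambda>x. t powi m x) \<rho> (insert x P) xs = t powi e"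
      by blast
    then show ?case
      by (intro exI[of _ "m x * (\<rho> (insert x P) - \<rho> P) + e"])
        (simp add: power_int_mult power_int_add)
  qed
  then show ?thesis using that by blast
qed

lemma one_minus_powi_limit:
  "((\<lambda>t::real. (1 - t powi e) / (1 - t)) \<longlongrightarrow> of_int e) (at_right 1)"
proof -
  have "((\<lambda>t::real. t powi e) has_real_derivative of_int e) (at 1)"
    by (auto intro!: derivative_eq_intros)
  then have "((\<lambda>t::real. (t powi e - 1) / (t - 1)) \<longlongrightarrow> of_int e) (at 1)"
    by (simp add: has_field_derivative_iff)
  then have "((\<lambda>t::real. (t powi e - 1) / (t - 1)) \<longlongrightarrow> of_int e) (at_right 1)"
    by (rule filterlim_mono) (auto simp: at_le)
  moreover have "(t powi e - 1) / (t - 1) = (1 - t powi e) / (1 - t)" for t :: real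
    by (metis minus_diff_eq minus_divide_divide)
  ultimately show ?thesis by simp
qed

text \<open>
  For distinct exponents \<open>m(x)\<close>, at the points \<open>z\<^sub>x = t\<^sup>m\<^sup>(\<^sup>x\<^sup>)\<close> the denominator vanishes at \<open>t = 1\<close> to order exactly one less than
  the length of a nonempty list.
\<close>

lemma cone_denominator_order:
  fixes m :: "'a \<Rightarrow> int"
  assumes "distinct xs" "inj_on m (set xs)"
  shows "\<exists>c. c \<noteq> 0 \<and> ((\<lambda>t. cone_denominator (\<lambda>x. t powi m x) xs / (1 - t) ^ (length xs - 1)) \<longlongrightarrow> c) (at_right 1)"
  using assms
proof (induction xs rule: induct_list012)
  case (3 x y xs)
  then obtain c where c: "c \<noteq> 0"
    "((\<lambda>t. cone_denominator (\<lambda>x. t powi m x) (y # xs) / (1 - t) ^ length xs) \<longlongrightarrow> c) (at_right 1)"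
    by auto
  define e where "e = m y - m x"
  have e: "e \<noteq> 0" using 3 by (auto simp: e_def)
  have "((\<lambda>t. (1 - t powi e) / (1 - t) * (cone_denominator (\<lambda>x. t powi m x) (y # xs) / (1 - t) ^ length xs))
     \<longlongrightarrow> of_int e * c) (at_right 1)"
    by (intro tendsto_mult one_minus_powi_limit c(2))
  moreover have "eventually (\<lambda>t. (1 - t powi e) / (1 - t) *
       (cone_denominator (\<lambda>x. t powi m x) (y # xs) / (1 - t) ^ length xs) =
      cone_denominator (\<lambda>x. t powi m x) (x # y # xs) / (1 - t) ^ (length (x # y # xs) - 1)) (at_right 1)"
    using eventually_at_right_less[of 1]
    by eventually_elim (simp add: e_def power_int_diff)
  ultimately have "((\<lambda>t. cone_denominator (\<lambda>x. t powi m x) (x # y # xs) / (1 - t) ^ (length (x # y # xs) - 1))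
     \<longlongrightarrow> of_int e * c) (at_right 1)"
    by (rule Lim_transform_eventually)
  then show ?case using e c(1) by (intro exI[of _ "of_int e * c"]) auto
qed auto

lemma powi_tendsto_1: "((\<lambda>t::real. t powi e) \<longlongrightarrow> 1) (at_right 1)"
proof -
  have "((\<lambda>t::real. t powi e) \<longlongrightarrow> 1 powi e) (at_right 1)"
    by (intro tendsto_intros) auto
  then show ?thesis by simp
qed

lemma alternating_vertex_term_tendsto_0:
  fixes m :: "'a \<Rightarrow> int"
  assumes "finite S" "S \<noteq> {}" "distinct xs" "inj_on m (set xs)" "length xs \<le> card S"
  shows "((\<lambda>t. vertex_monomial (\<lambda>x. t powi m x) \<rho> {} xs / cone_denominator (\<lambda>x. t powi m x) xs *
           (\<Prod>v\<in>S. 1 - vertex_monomial (\<lambda>x. t powi m x) (h v) {} xs)) \<longlongrightarrow> 0) (at_right 1)"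
proof -
  let ?z = "\<lambda>t x. t powi m x :: real"
  let ?n = "length xs - 1"
  obtain c where c: "c \<noteq> 0"
    "((\<lambda>t. cone_denominator (?z t) xs / (1 - t) ^ ?n) \<longlongrightarrow> c) (at_right 1)"
    using cone_denominator_order[OF assms(3,4)] by blast
  obtain e where e: "\<And>t::real. t > 0 \<Longrightarrow> vertex_monomial (?z t) \<rho> {} xs = t powi e"
    using vertex_monomial_power by blast
  have "\<exists>d. \<forall>t::real. t > 0 \<longrightarrow> vertex_monomial (?z t) (h v) {} xs = t powi d" for v
    using vertex_monomial_power[of m "h v" "{}" xs] by metis
  then obtain d where d: "\<And>v t. t > 0 \<Longrightarrow> vertex_monomial (?z t) (h v) {} xs = t powi d v"
    by metis
  have n: "?n < card S" using assms(1,2,5) by (metis card_gt_0_iff diff_less less_le_trans length_greater_0_conv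
        less_one list.size(3) diff_0_eq_0)
  have "((\<lambda>t. 1 - t) \<longlongrightarrow> (1 - 1 :: real)) (at_right 1)" by (intro tendsto_intros)
  then have lim0: "((\<lambda>t::real. (1 - t) ^ (card S - ?n)) \<longlongrightarrow> 0) (at_right 1)"
    using n tendsto_power[of "\<lambda>t. 1 - t" 0 "at_right 1" "card S - ?n"] by simp
  \<comment> \<open>Of the \<open>card S\<close> factors \<open>1 - t\<close> in the numerator, \<open>length xs - 1\<close> compensate the denominator
    and at least one is left over.\<close>
  have "((\<lambda>t. t powi e * (\<Prod>v\<in>S. (1 - t powi d v) / (1 - t)) /
      (cone_denominator (?z t) xs / (1 - t) ^ ?n) * (1 - t) ^ (card S - ?n))
    \<longlongrightarrow> 1 * (\<Prod>v\<in>S. of_int (d v)) / c * 0) (at_right 1)"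
    by (intro tendsto_mult tendsto_divide tendsto_prod powi_tendsto_1 one_minus_powi_limit c lim0)
  moreover have "eventually (\<lambda>t. t powi e * (\<Prod>v\<in>S. (1 - t powi d v) / (1 - t)) /
      (cone_denominator (?z t) xs / (1 - t) ^ ?n) * (1 - t) ^ (card S - ?n) =
      vertex_monomial (?z t) \<rho> {} xs / cone_denominator (?z t) xs *
           (\<Prod>v\<in>S. 1 - vertex_monomial (?z t) (h v) {} xs)) (at_right 1)"
    using eventually_at_right_less[of 1]
  proof eventually_elim
    case (elim t)
    have p: "(1 - t) ^ ?n * (1 - t) ^ (card S - ?n) = (1 - t) ^ card S"
      using n by (simp flip: power_add)
    have "t powi e * (\<Prod>v\<in>S. (1 - t powi d v) / (1 - t)) /
      (cone_denominator (?z t) xs / (1 - t) ^ ?n) * (1 - t) ^ (card S - ?n) =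
      t powi e / cone_denominator (?z t) xs * (\<Prod>v\<in>S. 1 - t powi d v) *
        (((1 - t) ^ ?n * (1 - t) ^ (card S - ?n)) / (1 - t) ^ card S)"
      by (simp add: prod_dividef mult_ac)
    also have "\<dots> = t powi e / cone_denominator (?z t) xs * (\<Prod>v\<in>S. 1 - t powi d v)"
      unfolding p using elim by simp
    finally show ?case using elim by (simp add: e d)
  qed
  ultimately show ?thesis using Lim_transform_eventually by fastforce
qed

text \<open>
  As a function of the submodular function, the number of integer points of a base polytope on
  \<open>A\<close> behaves like a polynomial of degree less than \<open>card A\<close>: its mixed differences in at
  least \<open>card A\<close> directions, and in at least one, vanish.
\<close>

theorem alternating_base_points_count:
  fixes \<rho> :: "'a set \<Rightarrow> int" and h :: "'b \<Rightarrow> 'a set \<Rightarrow> int"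
  assumes S: "finite S" "S \<noteq> {}" and A: "finite A" "card A \<le> card S"
    and sm: "submodular_on A \<rho>" "\<And>v. v \<in> S \<Longrightarrow> submodular_on A (h v)"
  shows "(\<Sum>T\<in>Pow S. (- 1) ^ card T * int (card (base_points A (\<lambda>X. \<rho> X + (\<Sum>v\<in>T. h v X))))) = 0"
proof -
  obtain m :: "'a \<Rightarrow> int" where m: "inj_on m A"
  proof -
    obtain f :: "'a \<Rightarrow> nat" where "inj_on f A"
      using finite_imp_inj_to_nat_seg[OF A(1)] by blast
    then have "inj_on (\<lambda>x. int (f x)) A" by (simp add: inj_on_def)
    then show ?thesis by (rule that)
  qed
  let ?z = "\<lambda>t x. t powi m x :: real"
  let ?\<rho> = "\<lambda>T X. \<rho> X + (\<Sum>v\<in>T. h v X)"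
  have smT: "submodular_on A (?\<rho> T)" if "T \<subseteq> S" for T
    using that by (intro submodular_on_add sm submodular_on_sum) auto
  define F where "F t = (\<Sum>T\<in>Pow S. (- 1) ^ card T *
      (\<Sum>b\<in>base_points A (?\<rho> T). \<Prod>x\<in>A. ?z t x powi b x))" for t
  have "(F \<longlongrightarrow> (\<Sum>T\<in>Pow S. (- 1) ^ card T * (\<Sum>b\<in>base_points A (?\<rho> T). \<Prod>x\<in>A. 1))) (at_right 1)"
    unfolding F_def power_int_mult[symmetric] by (intro tendsto_intros powi_tendsto_1)
  moreover have "(F \<longlongrightarrow> 0) (at_right 1)"
  proof -
    have "((\<lambda>t. \<Sum>xs\<in>permutations_of_set A. vertex_monomial (?z t) \<rho> {} xs / cone_denominator (?z t) xs *
           (\<Prod>v\<in>S. 1 - vertex_monomial (?z t) (h v) {} xs)) \<longlongrightarrow> (\<Sum>xs\<in>permutations_of_set A. 0)) (at_right 1)"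
    proof (intro tendsto_sum alternating_vertex_term_tendsto_0 S)
      fix xs assume "xs \<in> permutations_of_set A"
      then have "set xs = A" "distinct xs" by (auto dest: permutations_of_setD)
      then show "distinct xs" "inj_on m (set xs)" "length xs \<le> card S"
        using m A by (auto simp: distinct_card[symmetric])
    qed
    moreover have "eventually (\<lambda>t. (\<Sum>xs\<in>permutations_of_set A. vertex_monomial (?z t) \<rho> {} xs / cone_denominator (?z t) xs *
           (\<Prod>v\<in>S. 1 - vertex_monomial (?z t) (h v) {} xs)) = F t) (at_right 1)"
      using eventually_at_right_less[of 1]
    proof eventually_elim
      case (elim t)
      have nz: "?z t x \<noteq> 0" for x using elim by simp
      have inj: "inj_on (?z t) A"
      proof (rule inj_onI)
        fix x y assume "x \<in> A" "y \<in> A" "?z t x = ?z t y"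
        moreover have "m x = m y"
          using \<open>?z t x = ?z t y\<close> elim power_int_strict_increasing[of "m x" "m y" t]
            power_int_strict_increasing[of "m y" "m x" t] by (metis less_irrefl linorder_neqE)
        ultimately show "x = y" using m by (auto dest: inj_onD)
      qed
      have "F t = (\<Sum>T\<in>Pow S. (- 1) ^ card T *
          (\<Sum>xs\<in>permutations_of_set A. vertex_monomial (?z t) (?\<rho> T) {} xs / cone_denominator (?z t) xs))"
        unfolding F_def
      proof (intro sum.cong refl arg_cong[where f = "\<lambda>s. _ * s"])
        fix T assume "T \<in> Pow S"
        then show "(\<Sum>b\<in>base_points A (?\<rho> T). \<Prod>x\<in>A. ?z t x powi b x) =
          (\<Sum>xs\<in>permutations_of_set A. vertex_monomial (?z t) (?\<rho> T) {} xs / cone_denominator (?z t) xs)"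
          by (intro brion_base_points A(1) smT inj nz) auto
      qed
      also have "\<dots> = (\<Sum>T\<in>Pow S. \<Sum>xs\<in>permutations_of_set A.
           vertex_monomial (?z t) \<rho> {} xs / cone_denominator (?z t) xs *
           ((- 1) ^ card T * (\<Prod>v\<in>T. vertex_monomial (?z t) (h v) {} xs)))"
        unfolding sum_distrib_left
      proof (intro sum.cong refl)
        fix T xs assume "T \<in> Pow S"
        then have T: "finite T" using S(1) finite_subset by blast
        have "vertex_monomial (?z t) (?\<rho> T) {} xs =
          vertex_monomial (?z t) \<rho> {} xs * (\<Prod>v\<in>T. vertex_monomial (?z t) (h v) {} xs)"
          by (subst vertex_monomial_add[OF nz], subst vertex_monomial_sum[OF nz T]) (rule refl)
        then show "(- 1) ^ card T * (vertex_monomial (?z t) (?\<rho> T) {} xs / cone_denominator (?z t) xs) =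
          vertex_monomial (?z t) \<rho> {} xs / cone_denominator (?z t) xs *
           ((- 1) ^ card T * (\<Prod>v\<in>T. vertex_monomial (?z t) (h v) {} xs))"
          by simp
      qed
      also have "\<dots> = (\<Sum>xs\<in>permutations_of_set A.
           vertex_monomial (?z t) \<rho> {} xs / cone_denominator (?z t) xs *
           (\<Prod>v\<in>S. 1 - vertex_monomial (?z t) (h v) {} xs))"
        by (subst sum.swap) (simp only: prod_one_minus_expand[OF S(1)] sum_distrib_left)
      finally show ?case by (rule sym)
    qed
    ultimately show ?thesis using Lim_transform_eventually by fastforce
  qed
  ultimately have "(\<Sum>T\<in>Pow S. (- 1) ^ card T * (\<Sum>b\<in>base_points A (?\<rho> T). \<Prod>x\<in>A. 1)) = (0::real)"
    by (intro tendsto_unique[of "at_right (1::real)" F]) auto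
  then have "real_of_int (\<Sum>T\<in>Pow S. (- 1) ^ card T * int (card (base_points A (?\<rho> T)))) = 0"
    by simp
  then show ?thesis by (simp only: of_int_eq_0_iff)
qed

text \<open>
  If the directions \<open>h v\<close> see only the part of \<open>X\<close> in \<open>U\<close>, then \<open>card U\<close> directions suffice:
  slicing at an element outside \<open>U\<close> commutes with adding \<open>h v\<close>.
\<close>

theorem alternating_base_points_count_local:
  fixes \<rho> :: "'a set \<Rightarrow> int" and h :: "'b \<Rightarrow> 'a set \<Rightarrow> int"
  assumes S: "finite S" "S \<noteq> {}" and A: "finite A" and U: "U \<subseteq> A" "card U \<le> card S"
    and "submodular_on A \<rho>" and h: "\<And>v. v \<in> S \<Longrightarrow> submodular_on A (h v)"
    and loc: "\<And>v X. v \<in> S \<Longrightarrow> h v X = h v (X \<inter> U)"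
  shows "(\<Sum>T\<in>Pow S. (- 1) ^ card T * int (card (base_points A (\<lambda>X. \<rho> X + (\<Sum>v\<in>T. h v X))))) = 0"
proof -
  have "(\<Sum>T\<in>Pow S. (- 1) ^ card T * int (card (base_points (U \<union> D) (\<lambda>X. \<rho> X + (\<Sum>v\<in>T. h v X))))) = 0"
    if "finite D" "D \<inter> U = {}" "submodular_on (U \<union> D) \<rho>"
      "\<And>v. v \<in> S \<Longrightarrow> submodular_on (U \<union> D) (h v)" for D \<rho>
    using that
  proof (induction D arbitrary: \<rho>)
    case empty
    then show ?case
      using alternating_base_points_count[OF S finite_subset[OF U(1) A] U(2), of \<rho> h] by simp
  next
    case (insert u D)
    let ?A = "U \<union> D"
    let ?\<rho> = "\<lambda>T X. \<rho> X + (\<Sum>v\<in>T. h v X)"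
    let ?K = "{\<rho> (insert u ?A) - \<rho> ?A..\<rho> {u}}"
    have A': "finite ?A" "u \<notin> ?A"
      using insert.hyps insert.prems(1) finite_subset[OF U(1) A] by auto
    have sm: "submodular_on (insert u ?A) \<rho>" and hm: "\<And>v. v \<in> S \<Longrightarrow> submodular_on (insert u ?A) (h v)"
      using insert.prems by simp_all
    have hu: "h v (insert u X) = h v X" if "v \<in> S" for v X
      using loc[OF that, of "insert u X"] loc[OF that, of X] A' by auto
    have "int (card (base_points (U \<union> insert u D) (?\<rho> T))) =
        (\<Sum>k\<in>?K. int (card (base_points ?A (\<lambda>X. slice \<rho> u k X + (\<Sum>v\<in>T. h v X)))))"
      if T: "T \<subseteq> S" for T
    proof -
      have hT: "(\<Sum>v\<in>T. h v (insert u X)) = (\<Sum>v\<in>T. h v X)" for X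
        using T hu by (intro sum.cong) auto
      have hT0: "(\<Sum>v\<in>T. h v {}) = 0"
        using T submodular_on_empty[OF hm] by (intro sum.neutral) auto
      have sl: "slice (?\<rho> T) u k = (\<lambda>X. slice \<rho> u k X + (\<Sum>v\<in>T. h v X))" for k
        by (rule ext) (simp add: slice_def hT)
      have "int (card (base_points (insert u ?A) (?\<rho> T))) =
        (\<Sum>k = ?\<rho> T (insert u ?A) - ?\<rho> T ?A..?\<rho> T {u}. int (card (base_points ?A (slice (?\<rho> T) u k))))"
        using sum_base_points_insert[OF A', of "?\<rho> T" "\<lambda>_. 1 :: int"] hT0 submodular_on_empty[OF sm] by simp
      also have "{?\<rho> T (insert u ?A) - ?\<rho> T ?A..?\<rho> T {u}} = ?K"
        using hT[of ?A] hT[of "{}"] hT0 by simp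
      finally show ?thesis by (simp add: sl)
    qed
    then have "(\<Sum>T\<in>Pow S. (- 1) ^ card T * int (card (base_points (U \<union> insert u D) (?\<rho> T)))) =
      (\<Sum>T\<in>Pow S. (- 1) ^ card T * (\<Sum>k\<in>?K. int (card (base_points ?A (\<lambda>X. slice \<rho> u k X + (\<Sum>v\<in>T. h v X))))))"
      by (intro sum.cong) auto
    also have "\<dots> = (\<Sum>k\<in>?K. \<Sum>T\<in>Pow S. (- 1) ^ card T *
        int (card (base_points ?A (\<lambda>X. slice \<rho> u k X + (\<Sum>v\<in>T. h v X)))))"
      unfolding sum_distrib_left by (rule sum.swap)
    also have "\<dots> = 0"
    proof (rule sum.neutral, rule ballI, rule insert.IH)
      fix k assume "k \<in> ?K"
      then show "submodular_on ?A (slice \<rho> u k)"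
        by (intro submodular_on_slice[OF sm A'(2)]) auto
      show "D \<inter> U = {}" using insert.prems(1) by auto
      show "submodular_on ?A (h v)" if "v \<in> S" for v
        by (rule submodular_on_subset[OF hm[OF that]]) auto
    qed
    finally show ?case .
  qed
  from this[of "A - U" \<rho>] show ?thesis
    using assms by (simp add: Un_absorb1 Int_commute)
qed

section \<open>Lattice points of dilated root polytopes\<close>

text \<open>
  The submodular function of the standard simplex with vertices the unit vectors of \<open>N\<close>.
\<close>

definition hits :: "'a set \<Rightarrow> 'a set \<Rightarrow> int" where
  "hits N X = (if N \<inter> X = {} then 0 else 1)"

lemma submodular_on_hits: "submodular_on A (hits N)"
proof -
  have "hits N (X \<union> Y) + hits N (X \<inter> Y) \<le> hits N X + hits N Y" for X Y
  proof -
    have "N \<inter> (X \<union> Y) = {} \<longleftrightarrow> N \<inter> X = {} \<and> N \<inter> Y = {}" by blast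
    moreover have "N \<inter> (X \<inter> Y) = {}" if "N \<inter> X = {} \<or> N \<inter> Y = {}" using that by blast
    ultimately show ?thesis
      unfolding hits_def by (cases "N \<inter> X = {}"; cases "N \<inter> Y = {}") simp_all
  qed
  then show ?thesis by (simp add: submodular_on_def hits_def)
qed

lemma hits_le_1: "hits N X \<le> 1"
  by (simp add: hits_def)

lemma hits_pos_iff: "hits N X > 0 \<longleftrightarrow> N \<inter> X \<noteq> {}"
  by (simp add: hits_def)

text \<open>
  Integer decomposition: an integer point of the Minkowski sum of a base polytope and the simplex
  on \<open>N\<close> is an integer point of the base polytope plus a unit vector of \<open>N\<close>. The sets \<open>X\<close> that
  prevent the subtraction of unit vectors are closed under intersection, so one of least
  cardinality leads to a contradiction.
\<close>

lemma base_points_add_hits: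
  assumes A: "finite A" and sm: "submodular_on A \<rho>" and N: "N \<subseteq> A" "N \<noteq> {}"
    and b: "b \<in> base_points A (\<lambda>X. \<rho> X + hits N X)"
  obtains w where "w \<in> N" "b(w := b w - 1) \<in> base_points A \<rho>"
proof (rule ccontr)
  assume "\<not> thesis"
  then have bad: "b(w := b w - 1) \<notin> base_points A \<rho>" if "w \<in> N" for w
    using that \<open>\<And>w. w \<in> N \<Longrightarrow> b(w := b w - 1) \<in> base_points A \<rho> \<Longrightarrow> thesis\<close> by blast
  have le: "sum b X \<le> \<rho> X + hits N X" if "X \<subseteq> A" for X
    using b that by (simp add: base_points_def)
  define tight where "tight X \<longleftrightarrow> X \<subseteq> A \<and> N \<inter> X \<noteq> {} \<and> sum b X = \<rho> X + 1" for X
  have "N \<inter> A \<noteq> {}" using N by blast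
  then have sumA: "sum b A = \<rho> A + 1" and "tight A"
    using b by (simp_all add: tight_def base_points_def hits_def)
  then obtain X where X: "tight X" and least: "\<And>Y. tight Y \<Longrightarrow> card X \<le> card Y"
    using ex_has_least_nat[of tight A card] by blast
  then obtain w where w: "w \<in> N" "w \<in> X" by (auto simp: tight_def)
  have XA: "X \<subseteq> A" using X by (simp add: tight_def)
  let ?b = "b(w := b w - 1)"
  have in_sum: "sum ?b Y = sum b Y - 1" if "w \<in> Y" "Y \<subseteq> A" for Y
  proof -
    have "sum ?b (Y - {w}) = sum b (Y - {w})" by (intro sum.cong) auto
    then show ?thesis using finite_subset[OF that(2) A] that(1) by (simp add: sum.remove)
  qed
  have out_sum: "sum ?b Y = sum b Y" if "w \<notin> Y" for Y
    using that by (intro sum.cong) auto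
  have "sum ?b A = \<rho> A"
    using in_sum[of A] w(2) XA sumA by auto
  moreover have "\<forall>x. x \<notin> A \<longrightarrow> ?b x = 0"
  proof (intro allI impI)
    fix x assume "x \<notin> A"
    moreover from this have "x \<noteq> w" using w(2) XA by blast
    ultimately show "?b x = 0" using b by (simp add: base_points_def)
  qed
  ultimately have "\<not> (\<forall>Y\<subseteq>A. sum ?b Y \<le> \<rho> Y)"
    using bad[OF w(1)] unfolding base_points_def by blast
  then obtain Y where Y: "Y \<subseteq> A" "\<not> sum ?b Y \<le> \<rho> Y" by blast
  have wY: "w \<notin> Y"
    using Y in_sum[of Y] le[OF Y(1)] hits_le_1[of N Y] by linarith
  have "hits N Y > 0" "sum b Y = \<rho> Y + 1"
    using Y(2) le[OF Y(1)] out_sum[OF wY] hits_le_1[of N Y] by linarith+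
  then have "tight Y" using Y(1) by (simp add: tight_def hits_pos_iff)
  have "sum b X + sum b Y = sum b (X \<union> Y) + sum b (X \<inter> Y)"
    using finite_subset[OF XA A] finite_subset[OF Y(1) A] by (simp add: sum.union_inter)
  moreover have "\<rho> (X \<union> Y) + \<rho> (X \<inter> Y) \<le> \<rho> X + \<rho> Y"
    by (rule submodular_onD[OF sm XA Y(1)])
  moreover have "sum b (X \<union> Y) \<le> \<rho> (X \<union> Y) + 1"
    using le[OF Un_least[OF XA Y(1)]] hits_le_1[of N "X \<union> Y"] by linarith
  ultimately have "sum b (X \<inter> Y) \<ge> \<rho> (X \<inter> Y) + 1"
    using X \<open>tight Y\<close> by (simp add: tight_def)
  moreover have sub: "X \<inter> Y \<subseteq> A" using XA by auto
  ultimately have "hits N (X \<inter> Y) > 0" "sum b (X \<inter> Y) = \<rho> (X \<inter> Y) + 1"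
    using le[OF sub] hits_le_1[of N "X \<inter> Y"] by linarith+
  then have "tight (X \<inter> Y)" using sub by (simp add: tight_def hits_pos_iff)
  then have "card X \<le> card (X \<inter> Y)" by (rule least)
  moreover have "card (X \<inter> Y) < card X"
    using w wY finite_subset[OF XA A] by (intro psubset_card_mono) auto
  ultimately show False by simp
qed

text \<open>
  The total weight of the left vertices with a neighbour in \<open>X\<close>. Its base polytope consists of
  the right marginals of the nonnegative flows on \<open>E\<close> with left marginal \<open>a\<close>, if \<open>a\<close> vanishes on
  isolated vertices.
\<close>

definition cover :: "('v::finite \<times> 'w) set \<Rightarrow> ('v \<Rightarrow> nat) \<Rightarrow> 'w set \<Rightarrow> int" where
  "cover E a X = (\<Sum>v\<in>UNIV. int (a v) * hits (E `` {v}) X)"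

lemma submodular_on_cover: "submodular_on A (cover E a)"
  unfolding cover_def[abs_def]
  by (intro submodular_on_sum submodular_on_scale submodular_on_hits) simp

lemma cover_add_indicator:
  "cover E (\<lambda>v. a v + of_bool (v \<in> T)) X = cover E a X + (\<Sum>v\<in>T. hits (E `` {v}) X)"
proof -
  have "(\<Sum>v\<in>T. hits (E `` {v}) X) = (\<Sum>v\<in>UNIV. of_bool (v \<in> T) * hits (E `` {v}) X)"
    by (rule sum.mono_neutral_cong_left) auto
  then show ?thesis by (simp add: cover_def sum.distrib distrib_right)
qed

text \<open>
  The lattice points of the \<open>s\<close>-th dilate of the root polytope, as pairs of their two
  components; \<open>Domain E\<close> is the set of left vertices that are not isolated.
\<close>

definition lattice_pairs :: "('v::finite \<times> 'w::finite) set \<Rightarrow> nat \<Rightarrow> (('v \<Rightarrow> nat) \<times> ('w \<Rightarrow> int)) set" where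
  "lattice_pairs E s =
     {(a, b). {v. a v \<noteq> 0} \<subseteq> Domain E \<and> sum a UNIV = s \<and> b \<in> base_points UNIV (cover E a)}"

definition real_point :: "('v::finite \<Rightarrow> nat) \<Rightarrow> ('w::finite \<Rightarrow> int) \<Rightarrow> (real^'v) \<times> (real^'w)" where
  "real_point a b = ((\<chi> v. real (a v)), (\<chi> w. real_of_int (b w)))"

lemma base_points_zero:
  assumes "finite A" "b \<in> base_points A (\<lambda>_. 0)"
  shows "b = (\<lambda>_. 0)"
proof
  fix x
  have nonpos: "b y \<le> 0" if "y \<in> A" for y
  proof -
    have "\<forall>X\<subseteq>A. sum b X \<le> 0" using assms(2) by (simp add: base_points_def)
    then have "sum b {y} \<le> 0" using that by blast
    then show ?thesis by simp
  qed
  have "sum (\<lambda>y. - b y) A = 0" using assms(2) by (simp add: base_points_def sum_negf)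
  then have "\<forall>y\<in>A. - b y = 0"
    using sum_nonneg_eq_0_iff[OF assms(1), of "\<lambda>y. - b y"] nonpos by auto
  then show "b x = 0" using assms(2) by (cases "x \<in> A") (auto simp: base_points_def)
qed

lemma lattice_pairs_0: "lattice_pairs E 0 = {(\<lambda>_. 0, \<lambda>_. 0)}"
proof -
  have c: "cover E (\<lambda>_. 0) = (\<lambda>_. 0)" by (simp add: cover_def fun_eq_iff)
  have "(a, b) = (\<lambda>_. 0, \<lambda>_. 0)" if ab: "(a, b) \<in> lattice_pairs E 0" for a b
  proof -
    have "sum a UNIV = 0" and b: "b \<in> base_points UNIV (cover E a)"
      using ab by (simp_all add: lattice_pairs_def)
    then have a: "a = (\<lambda>_. 0)" by (simp add: fun_eq_iff)
    have "b = (\<lambda>_. 0)" using b unfolding a c by (rule base_points_zero[OF finite])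
    with a show ?thesis by simp
  qed
  then have "lattice_pairs E 0 \<subseteq> {(\<lambda>_. 0, \<lambda>_. 0)}" by fast
  moreover have "(\<lambda>_. 0, \<lambda>_. 0) \<in> lattice_pairs E 0"
    by (simp add: lattice_pairs_def c base_points_def)
  ultimately show ?thesis by blast
qed

text \<open>
  The generators of the root polytope of a graph with edge set \<open>E\<close>.
\<close>

definition edge_vectors :: "('v::finite \<times> 'w::finite) set \<Rightarrow> ((real^'v) \<times> (real^'w)) set" where
  "edge_vectors E = {(axis v 1, 0) + (0, axis w 1) | v w. (v, w) \<in> E}"

text \<open>
  By integer decomposition such a pair is a sum of \<open>s\<close> edge vectors.
\<close>

lemma lattice_pair_in_dilation:
  assumes "edge_vectors E \<noteq> {}" "(a, b) \<in> lattice_pairs E s"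
  shows "\<exists>q\<in>convex hull (edge_vectors E). real_point a b = real s *\<^sub>R q"
  using assms(2)
proof (induction s arbitrary: a b)
  case 0
  then have "real_point a b = 0"
    by (simp add: lattice_pairs_0 real_point_def vec_eq_iff zero_prod_def)
  then show ?case using assms(1) by (metis all_not_in_conv hull_inc of_nat_0 scaleR_zero_left)
next
  case (Suc n)
  have sum: "sum a UNIV = Suc n" and dom: "{v. a v \<noteq> 0} \<subseteq> Domain E"
    and b: "b \<in> base_points UNIV (cover E a)"
    using Suc.prems by (auto simp: lattice_pairs_def)
  obtain v where v: "a v \<noteq> 0" using sum by (metis Zero_not_Suc sum.neutral)
  define a' where "a' = a(v := a v - 1)"
  have a: "a = (\<lambda>x. a' x + of_bool (x \<in> {v}))" using v by (auto simp: a'_def)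
  have "cover E a = (\<lambda>X. cover E a' X + hits (E `` {v}) X)"
    using cover_add_indicator[of E a' "{v}"] unfolding a[symmetric] by (intro ext) simp
  then have bh: "b \<in> base_points UNIV (\<lambda>X. cover E a' X + hits (E `` {v}) X)"
    using b by simp
  have ne: "E `` {v} \<noteq> {}" using dom v by auto
  obtain w where w: "w \<in> E `` {v}" and b': "b(w := b w - 1) \<in> base_points UNIV (cover E a')"
    by (rule base_points_add_hits[OF finite[of UNIV] submodular_on_cover subset_UNIV ne bh])
  define b' where "b' = b(w := b w - 1)"
  have "sum a UNIV = sum a' UNIV + (\<Sum>x\<in>UNIV. of_bool (x \<in> {v}))"
    by (subst a) (simp add: sum.distrib)
  then have "sum a' UNIV = n" using sum by simp
  moreover have "{x. a' x \<noteq> 0} \<subseteq> {x. a x \<noteq> 0}" by (auto simp: a'_def)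
  then have "{x. a' x \<noteq> 0} \<subseteq> Domain E" using dom by (rule subset_trans)
  ultimately have "(a', b') \<in> lattice_pairs E n"
    using b' by (simp add: lattice_pairs_def b'_def)
  then obtain q where q: "q \<in> convex hull (edge_vectors E)" "real_point a' b' = real n *\<^sub>R q"
    using Suc.IH by blast
  define e where "e = ((axis v 1, 0) + (0, axis w 1) :: (real^'a) \<times> (real^'b))"
  have "e \<in> edge_vectors E" using w unfolding e_def edge_vectors_def by blast
  then have e: "e \<in> convex hull (edge_vectors E)" by (rule hull_inc)
  have "real_point a b = real_point a' b' + e"
    using v by (auto simp: real_point_def e_def a'_def b'_def vec_eq_iff axis_def of_nat_diff)
  also have "\<dots> = real (Suc n) *\<^sub>R ((real n / real (Suc n)) *\<^sub>R q + (1 / real (Suc n)) *\<^sub>R e)"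
    by (simp add: q(2) scaleR_add_right)
  finally have "real_point a b = \<dots>" .
  moreover have "(real n / real (Suc n)) *\<^sub>R q + (1 / real (Suc n)) *\<^sub>R e \<in> convex hull (edge_vectors E)"
    by (rule convexD[OF convex_convex_hull q(1) e]) (auto simp: field_simps)
  ultimately show ?case by blast
qed

lemma edge_hull_inequalities:
  fixes E :: "('v::finite \<times> 'w::finite) set"
  assumes "(x, y) \<in> convex hull (edge_vectors E)"
  shows "x $ v \<ge> 0" "v \<notin> Domain E \<Longrightarrow> x $ v = 0" "(\<Sum>v\<in>UNIV. x $ v) = 1" "(\<Sum>w\<in>UNIV. y $ w) = 1"
    "(\<Sum>w\<in>X. y $ w) \<le> (\<Sum>v\<in>UNIV. x $ v * of_int (hits (E `` {v}) X))"
proof -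
  define C :: "((real^'v) \<times> (real^'w)) set" where
    "C = {p. (\<forall>v. fst p $ v \<ge> 0) \<and> (\<forall>v. v \<notin> Domain E \<longrightarrow> fst p $ v = 0) \<and>
       (\<Sum>v\<in>UNIV. fst p $ v) = 1 \<and> (\<Sum>w\<in>UNIV. snd p $ w) = 1 \<and>
       (\<forall>X. (\<Sum>w\<in>X. snd p $ w) \<le> (\<Sum>v\<in>UNIV. fst p $ v * of_int (hits (E `` {v}) X)))}"
  have "convex C"
  proof (rule convexI)
    fix p q :: "(real^'v) \<times> (real^'w)" and c d :: real
    assume p: "p \<in> C" and q: "q \<in> C" and cd: "0 \<le> c" "0 \<le> d" "c + d = 1"
    have 1: "(\<Sum>v\<in>UNIV. fst (c *\<^sub>R p + d *\<^sub>R q) $ v * r v) =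
        c * (\<Sum>v\<in>UNIV. fst p $ v * r v) + d * (\<Sum>v\<in>UNIV. fst q $ v * r v)" for r
      by (simp add: sum.distrib sum_distrib_left algebra_simps)
    have 2: "(\<Sum>w\<in>X. snd (c *\<^sub>R p + d *\<^sub>R q) $ w) =
        c * (\<Sum>w\<in>X. snd p $ w) + d * (\<Sum>w\<in>X. snd q $ w)" for X
      by (simp add: sum.distrib sum_distrib_left)
    have "(\<Sum>w\<in>X. snd (c *\<^sub>R p + d *\<^sub>R q) $ w) \<le>
        (\<Sum>v\<in>UNIV. fst (c *\<^sub>R p + d *\<^sub>R q) $ v * of_int (hits (E `` {v}) X))" for X
      unfolding 1 2 using p q cd by (intro add_mono mult_left_mono) (auto simp: C_def)
    moreover have "(\<Sum>v\<in>UNIV. fst (c *\<^sub>R p + d *\<^sub>R q) $ v) = 1"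
      using 1[of "\<lambda>_. 1"] p q cd by (simp add: C_def)
    moreover have "(\<Sum>w\<in>UNIV. snd (c *\<^sub>R p + d *\<^sub>R q) $ w) = 1"
      unfolding 2 using p q cd by (simp add: C_def)
    moreover have "fst (c *\<^sub>R p + d *\<^sub>R q) $ v \<ge> 0" for v
      using p q cd by (simp add: C_def)
    moreover have "fst (c *\<^sub>R p + d *\<^sub>R q) $ v = 0" if "v \<notin> Domain E" for v
      using p q that by (simp add: C_def)
    ultimately show "c *\<^sub>R p + d *\<^sub>R q \<in> C" unfolding C_def by blast
  qed
  moreover have "edge_vectors E \<subseteq> C"
  proof
    fix p assume "p \<in> edge_vectors E"
    then obtain v w where vw: "(v, w) \<in> E" and p: "p = (axis v 1, axis w 1)"
      by (auto simp: edge_vectors_def)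
    have ax: "(\<Sum>v'\<in>UNIV. (axis v 1 :: real^'v) $ v' * r v') = r v" for r
      by (simp add: axis_def if_distrib[of "\<lambda>t. t * _"] cong: if_cong)
    have ax1: "(\<Sum>v'\<in>UNIV. (axis v 1 :: real^'v) $ v') = 1" using ax[of "\<lambda>_. 1"] by simp
    have ay: "(\<Sum>w'\<in>X. (axis w 1 :: real^'w) $ w') = of_bool (w \<in> X)" for X
      by (simp add: axis_def)
    have "of_bool (w \<in> X) \<le> real_of_int (hits (E `` {v}) X)" for X
      using vw by (auto simp: hits_def)
    moreover have "(axis v 1 :: real^'v) $ v' \<ge> 0" for v' by (simp add: axis_def)
    moreover have "(axis v 1 :: real^'v) $ v' = 0" if "v' \<notin> Domain E" for v'
      using that vw by (auto simp: axis_def)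
    ultimately show "p \<in> C" by (simp add: C_def p ax ax1 ay)
  qed
  ultimately have "convex hull (edge_vectors E) \<subseteq> C" by (intro hull_minimal)
  then have "(x, y) \<in> C" using assms by blast
  then show "x $ v \<ge> 0" "v \<notin> Domain E \<Longrightarrow> x $ v = 0" "(\<Sum>v\<in>UNIV. x $ v) = 1" "(\<Sum>w\<in>UNIV. y $ w) = 1"
    "(\<Sum>w\<in>X. y $ w) \<le> (\<Sum>v\<in>UNIV. x $ v * of_int (hits (E `` {v}) X))"
    by (simp_all add: C_def)
qed

lemma dilation_lattice_points:
  assumes s: "s > 0"
  shows "(\<lambda>p. real s *\<^sub>R p) ` (convex hull (edge_vectors E)) \<inter> lattice_points =
    (\<lambda>(a, b). real_point a b) ` lattice_pairs E s" (is "?L = ?R")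
proof
  show "?R \<subseteq> ?L"
  proof
    fix p assume "p \<in> ?R"
    then obtain a b where ab: "(a, b) \<in> lattice_pairs E s" and p: "p = real_point a b" by auto
    have "sum a UNIV \<noteq> 0" using ab s by (auto simp: lattice_pairs_def)
    then obtain v where "a v \<noteq> 0" by (metis sum.neutral)
    then have "edge_vectors E \<noteq> {}"
      using ab by (fastforce simp: lattice_pairs_def edge_vectors_def)
    then obtain q where "q \<in> convex hull (edge_vectors E)" "p = real s *\<^sub>R q"
      using lattice_pair_in_dilation[OF _ ab] p by blast
    moreover have "p \<in> lattice_points" by (simp add: p real_point_def lattice_points_def)
    ultimately show "p \<in> ?L" by blast
  qed
  show "?L \<subseteq> ?R"
  proof
    fix p assume p: "p \<in> ?L"
    then obtain x y where xy: "(x, y) \<in> convex hull (edge_vectors E)" and p_eq: "p = (real s *\<^sub>R x, real s *\<^sub>R y)"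
      by auto
    note ineq = edge_hull_inequalities[OF xy]
    define a where "a v = nat \<lfloor>fst p $ v\<rfloor>" for v
    define b where "b w = \<lfloor>snd p $ w\<rfloor>" for w
    have a: "real (a v) = s * x $ v" for v
    proof -
      have "fst p $ v \<in> \<int>" using p by (simp add: lattice_points_def)
      moreover have "fst p $ v \<ge> 0" using ineq(1)[of v] by (simp add: p_eq)
      ultimately have "real (a v) = fst p $ v" by (auto simp: a_def elim!: Ints_cases)
      then show ?thesis by (simp add: p_eq)
    qed
    have b: "real_of_int (b w) = s * y $ w" for w
    proof -
      have "snd p $ w \<in> \<int>" using p by (simp add: lattice_points_def)
      then have "real_of_int (b w) = snd p $ w" by (auto simp: b_def elim!: Ints_cases)
      then show ?thesis by (simp add: p_eq)
    qed
    have pt: "p = real_point a b" by (simp add: p_eq real_point_def a b vec_eq_iff)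
    have suma: "sum a UNIV = s"
    proof -
      have "real (sum a UNIV) = real s * (\<Sum>v\<in>UNIV. x $ v)" by (simp add: a sum_distrib_left)
      also have "\<dots> = real s" by (simp add: ineq(3))
      finally show ?thesis by (simp only: of_nat_eq_iff)
    qed
    have sumb: "sum b UNIV = s"
    proof -
      have "real_of_int (sum b UNIV) = s * (\<Sum>w\<in>UNIV. y $ w)" by (simp add: b sum_distrib_left)
      then show ?thesis using ineq(4) by (metis mult.right_neutral of_int_eq_iff of_int_of_nat_eq)
    qed
    have dom: "{v. a v \<noteq> 0} \<subseteq> Domain E"
    proof (rule subsetI, rule ccontr)
      fix v assume "v \<in> {v. a v \<noteq> 0}" "v \<notin> Domain E"
      then show False using a[of v] ineq(2)[of v] by simp
    qed
    have le: "sum b X \<le> cover E a X" for X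
    proof -
      have "real_of_int (sum b X) = s * (\<Sum>w\<in>X. y $ w)" by (simp add: b sum_distrib_left)
      also have "\<dots> \<le> s * (\<Sum>v\<in>UNIV. x $ v * of_int (hits (E `` {v}) X))"
        by (intro mult_left_mono ineq(5)) simp
      also have "\<dots> = real_of_int (cover E a X)"
        by (simp add: cover_def a sum_distrib_left mult.assoc)
      finally show ?thesis by (simp only: of_int_le_iff)
    qed
    have "cover E a UNIV \<le> (\<Sum>v\<in>UNIV. int (a v))"
      unfolding cover_def by (intro sum_mono) (simp add: hits_def)
    also have "\<dots> = int s" by (simp flip: suma)
    finally have "sum b UNIV = cover E a UNIV" using le[of UNIV] sumb by simp
    then have "(a, b) \<in> lattice_pairs E s"
      using dom suma le by (simp add: lattice_pairs_def base_points_def)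
    then show "p \<in> ?R" using pt by force
  qed
qed

lemma ehrhart_eq_card_lattice_pairs:
  assumes "s > 0"
  shows "ehrhart (root_polytope G) s = card (lattice_pairs (edges G) s)"
proof -
  have "inj_on (\<lambda>(a, b). real_point a b) (lattice_pairs (edges G) s)"
    by (auto simp: inj_on_def real_point_def vec_eq_iff)
  moreover have "root_polytope G = convex hull (edge_vectors (edges G))"
    by (simp add: root_polytope_def edge_vectors_def)
  ultimately show ?thesis
    by (simp add: ehrhart_def dilation_lattice_points[OF assms] card_image)
qed

lemma ehrhart_series_nth:
  "fps_nth (ehrhart_series (root_polytope G)) s = of_nat (card (lattice_pairs (edges G) s))"
proof (cases "s = 0")
  case True
  then show ?thesis by (simp add: ehrhart_series_def lattice_pairs_0)
next
  case False
  then have "ehrhart (root_polytope G) s = card (lattice_pairs (edges G) s)"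
    by (intro ehrhart_eq_card_lattice_pairs) simp
  then show ?thesis using False by (simp add: ehrhart_series_def)
qed

section \<open>The alternating sum of Ehrhart series\<close>

text \<open>
  The vectors of natural numbers with sum \<open>n\<close> and support in \<open>R\<close>.
\<close>

definition compositions :: "nat \<Rightarrow> 'v::finite set \<Rightarrow> ('v \<Rightarrow> nat) set" where
  "compositions n R = {a. sum a UNIV = n \<and> {v. a v \<noteq> 0} \<subseteq> R}"

text \<open>
  The number of lattice points whose left component is \<open>a\<close>.
\<close>

definition fibre_count :: "('v::finite \<times> 'w::finite) set \<Rightarrow> ('v \<Rightarrow> nat) \<Rightarrow> nat" where
  "fibre_count E a = card (base_points UNIV (cover E a))"

lemma finite_compositions: "finite (compositions n (R :: 'v::finite set))"
proof (rule finite_subset)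
  show "finite {a. \<forall>x. (x \<in> (UNIV :: 'v set) \<longrightarrow> a x \<in> {..n}) \<and> (x \<notin> UNIV \<longrightarrow> a x = 0)}"
    by (intro finite_set_of_finite_funs) auto
  have "a x \<le> n" if "sum a UNIV = n" for a :: "'v \<Rightarrow> nat" and x
    using member_le_sum[of x UNIV a] that by simp
  then show "compositions n R \<subseteq> {a. \<forall>x. (x \<in> UNIV \<longrightarrow> a x \<in> {..n}) \<and> (x \<notin> UNIV \<longrightarrow> a x = 0)}"
    by (auto simp: compositions_def)
qed

lemma card_lattice_pairs:
  "card (lattice_pairs E n) = (\<Sum>a\<in>compositions n (Domain E). fibre_count E a)"
proof -
  have "lattice_pairs E n = Sigma (compositions n (Domain E)) (\<lambda>a. base_points UNIV (cover E a))"
    by (auto simp: lattice_pairs_def compositions_def)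
  then show ?thesis
    by (simp add: fibre_count_def card_SigmaI finite_compositions finite_base_points)
qed

lemma card_lattice_pairs_delete_left:
  "card (lattice_pairs (edges (delete_left G J)) n) =
     (\<Sum>a\<in>compositions n (Domain (edges G) - J). fibre_count (edges G) a)"
proof -
  let ?E = "edges (delete_left G J)"
  have "Domain ?E = Domain (edges G) - J"
    by (auto simp: delete_left_def)
  moreover have "fibre_count ?E a = fibre_count (edges G) a"
    if "a \<in> compositions n (Domain (edges G) - J)" for a
  proof -
    have "int (a v) * hits (?E `` {v}) X = int (a v) * hits (edges G `` {v}) X" for v X
    proof (cases "v \<in> J")
      case True
      then have "a v = 0" using that by (auto simp: compositions_def)
      then show ?thesis by simp
    next
      case False
      then have "?E `` {v} = edges G `` {v}" by (auto simp: delete_left_def)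
      then show ?thesis by simp
    qed
    then have "cover ?E a = cover (edges G) a"
      unfolding cover_def by (intro ext sum.cong refl)
    then show ?thesis by (simp add: fibre_count_def)
  qed
  ultimately show ?thesis by (simp add: card_lattice_pairs)
qed

lemma hits_restrict:
  assumes "N \<subseteq> U"
  shows "hits N X = hits N (X \<inter> U)"
proof -
  have "N \<inter> X = {} \<longleftrightarrow> N \<inter> (X \<inter> U) = {}" using assms by blast
  then show ?thesis by (simp add: hits_def)
qed

text \<open>
  The mixed backward difference of the fibre count in the directions of \<open>S\<close> vanishes. The
  bound on the size of the neighbourhood of \<open>S\<close> enters here. The truncated subtraction is harmless, as
  \<open>a\<close> is positive on \<open>S\<close>.
\<close>

lemma alternating_fibre_count:
  assumes S: "S \<noteq> {}" "card (E `` S) \<le> card S" and a: "S \<subseteq> {v. a v \<noteq> 0}"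
  shows "(\<Sum>T\<in>Pow S. (- 1) ^ card T * int (fibre_count E (\<lambda>v. a v - of_bool (v \<in> T)))) = 0"
proof -
  define c where "c v = a v - of_bool (v \<in> S)" for v
  have fS: "finite S" by simp
  have "(\<Sum>T\<in>Pow S. (- 1) ^ card T * int (card (base_points UNIV
      (\<lambda>X. cover E c X + (\<Sum>v\<in>T. hits (E `` {v}) X))))) = 0"
  proof (rule alternating_base_points_count_local[OF fS S(1) finite subset_UNIV S(2)])
    show "hits (E `` {v}) X = hits (E `` {v}) (X \<inter> E `` S)" if "v \<in> S" for v X
      using that by (intro hits_restrict) auto
  qed (rule submodular_on_cover submodular_on_hits)+
  then have 0: "(\<Sum>T\<in>Pow S. (- 1) ^ card T * int (fibre_count E (\<lambda>v. c v + of_bool (v \<in> T)))) = 0"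
    by (simp only: fibre_count_def cover_add_indicator[abs_def])
  have "(\<Sum>T\<in>Pow S. (- 1) ^ card T * int (fibre_count E (\<lambda>v. a v - of_bool (v \<in> T)))) =
    (\<Sum>T\<in>Pow S. (- 1) ^ card S * ((- 1) ^ card T * int (fibre_count E (\<lambda>v. c v + of_bool (v \<in> T)))))"
  proof (rule sum.reindex_bij_witness[where i = "\<lambda>T. S - T" and j = "\<lambda>T. S - T"])
    fix T assume T: "T \<in> Pow S"
    have "c v + of_bool (v \<in> S - T) = a v - of_bool (v \<in> T)" for v
      using a T by (auto simp: c_def)
    then have 1: "(\<lambda>v. c v + of_bool (v \<in> S - T)) = (\<lambda>v. a v - of_bool (v \<in> T))" by (rule ext)
    have "card S = card T + card (S - T)"
      using T card_mono[OF fS, of T] by (simp add: card_Diff_subset finite_subset[OF _ fS])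
    then have 2: "(- 1) ^ card S * (- 1) ^ card (S - T) = ((- 1) ^ card T :: int)"
      by (simp add: power_add mult.assoc flip: power_mult_distrib)
    show "(- 1) ^ card S * ((- 1) ^ card (S - T) * int (fibre_count E (\<lambda>v. c v + of_bool (v \<in> S - T)))) =
      (- 1) ^ card T * int (fibre_count E (\<lambda>v. a v - of_bool (v \<in> T)))"
      unfolding 1 mult.assoc[symmetric] 2 ..
  qed auto
  also have "\<dots> = 0" unfolding sum_distrib_left[symmetric] 0 by simp
  finally show ?thesis .
qed

text \<open>
  Multiplication of the generating function by \<open>x\<^sup>|\<^sup>T\<^sup>|\<close>, realised as the shift \<open>a \<mapsto> a + 1\<^sub>T\<close>.
\<close>

lemma sum_compositions_shift:
  fixes f :: "('v::finite \<Rightarrow> nat) \<Rightarrow> 'b::comm_monoid_add"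
  assumes T: "T \<subseteq> R"
  shows "(if n < card T then 0 else \<Sum>a\<in>compositions (n - card T) R. f a) =
    (\<Sum>a | a \<in> compositions n R \<and> T \<subseteq> {v. a v \<noteq> 0}. f (\<lambda>v. a v - of_bool (v \<in> T)))"
proof -
  have ind: "(\<Sum>v\<in>UNIV. of_bool (v \<in> T)) = card T" by simp
  have card_le: "card T \<le> n" and sub_sum: "(\<Sum>v\<in>UNIV. a v - of_bool (v \<in> T)) = n - card T"
    if "sum a UNIV = n" "T \<subseteq> {v. a v \<noteq> 0}" for a
  proof -
    have "a v = (a v - of_bool (v \<in> T)) + of_bool (v \<in> T)" for v using that(2) by auto
    then have "sum a UNIV = (\<Sum>v\<in>UNIV. (a v - of_bool (v \<in> T)) + of_bool (v \<in> T))" by presburger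
    then have "n = (\<Sum>v\<in>UNIV. a v - of_bool (v \<in> T)) + card T"
      by (simp only: sum.distrib ind that(1))
    then show "card T \<le> n" "(\<Sum>v\<in>UNIV. a v - of_bool (v \<in> T)) = n - card T" by simp_all
  qed
  show ?thesis
  proof (cases "n < card T")
    case True
    then have "{a. a \<in> compositions n R \<and> T \<subseteq> {v. a v \<noteq> 0}} = {}"
      using card_le by (fastforce simp: compositions_def)
    then show ?thesis using True by (simp only: sum.empty if_True)
  next
    case False
    have "(\<Sum>a | a \<in> compositions n R \<and> T \<subseteq> {v. a v \<noteq> 0}. f (\<lambda>v. a v - of_bool (v \<in> T))) =
      (\<Sum>a\<in>compositions (n - card T) R. f a)"
    proof (rule sum.reindex_bij_witness[where i = "\<lambda>a v. a v + of_bool (v \<in> T)"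
          and j = "\<lambda>a v. a v - of_bool (v \<in> T)"])
      fix a assume a: "a \<in> {a. a \<in> compositions n R \<and> T \<subseteq> {v. a v \<noteq> 0}}"
      show "(\<lambda>v. (a v - of_bool (v \<in> T)) + of_bool (v \<in> T)) = a"
      proof
        show "(a v - of_bool (v \<in> T)) + of_bool (v \<in> T) = a v" for v using a by auto
      qed
      have "sum a UNIV = n" "{v. a v \<noteq> 0} \<subseteq> R" "T \<subseteq> {v. a v \<noteq> 0}"
        using a by (simp_all add: compositions_def)
      moreover from this have "{v. a v - of_bool (v \<in> T) \<noteq> 0} \<subseteq> R" by auto
      ultimately show "(\<lambda>v. a v - of_bool (v \<in> T)) \<in> compositions (n - card T) R"
        using sub_sum[of a] by (simp only: compositions_def mem_Collect_eq simp_thms)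
    next
      fix a assume a: "a \<in> compositions (n - card T) R"
      show "(\<lambda>v. (a v + of_bool (v \<in> T)) - of_bool (v \<in> T)) = a" by simp
      have "sum a UNIV = n - card T" "{v. a v \<noteq> 0} \<subseteq> R" using a by (simp_all add: compositions_def)
      then have "(\<Sum>v\<in>UNIV. a v + of_bool (v \<in> T)) = n"
        using False by (simp only: sum.distrib ind)
      moreover have "{v. a v + of_bool (v \<in> T) \<noteq> 0} \<subseteq> R"
        using \<open>{v. a v \<noteq> 0} \<subseteq> R\<close> T by auto
      moreover have "T \<subseteq> {v. a v + of_bool (v \<in> T) \<noteq> 0}" by auto
      ultimately show "(\<lambda>v. a v + of_bool (v \<in> T)) \<in> {a. a \<in> compositions n R \<and> T \<subseteq> {v. a v \<noteq> 0}}"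
        by (simp only: compositions_def mem_Collect_eq simp_thms)
    qed (rule refl)
    then show ?thesis using False by simp
  qed
qed

text \<open>
  For fixed support \<open>P\<close> the sums over \<open>J \<subseteq> S - P\<close> and \<open>T \<subseteq> S \<inter> P\<close> separate, and the first one vanishes
  unless \<open>S \<subseteq> P\<close>.
\<close>

lemma signed_pair_sum_eq_0:
  fixes f :: "'v set \<Rightarrow> rat"
  assumes S: "finite S" and f: "S \<subseteq> P \<Longrightarrow> (\<Sum>T\<in>Pow S. (- 1) ^ card T * f T) = 0"
  shows "(\<Sum>J\<in>Pow S. \<Sum>T\<in>Pow (S - J).
     if P \<inter> J = {} \<and> T \<subseteq> P then (- 1) ^ card J * ((- 1) ^ card T * f T) else 0) = 0"
proof -
  define g where "g = (\<Sum>T\<in>Pow (S \<inter> P). (- 1) ^ card T * f T)"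
  have inner: "(\<Sum>T\<in>Pow (S - J). if P \<inter> J = {} \<and> T \<subseteq> P then (- 1) ^ card J * ((- 1) ^ card T * f T) else 0) =
     (if P \<inter> J = {} then (- 1) ^ card J * g else 0)" if J: "J \<subseteq> S" for J
  proof (cases "P \<inter> J = {}")
    case True
    have "(\<Sum>T\<in>Pow (S - J). if P \<inter> J = {} \<and> T \<subseteq> P then (- 1) ^ card J * ((- 1) ^ card T * f T) else 0) =
      (\<Sum>T\<in>Pow (S \<inter> P). (- 1) ^ card J * ((- 1) ^ card T * f T))"
      by (rule sum.mono_neutral_cong_right) (use S True J in auto)
    then show ?thesis using True by (simp add: g_def sum_distrib_left)
  qed simp
  have "(\<Sum>J\<in>Pow S. \<Sum>T\<in>Pow (S - J).
     if P \<inter> J = {} \<and> T \<subseteq> P then (- 1) ^ card J * ((- 1) ^ card T * f T) else 0) =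
     (\<Sum>J\<in>Pow S. if P \<inter> J = {} then (- 1) ^ card J * g else 0)"
    using inner by (intro sum.cong) auto
  also have "\<dots> = (\<Sum>J\<in>Pow (S - P). (- 1) ^ card J * g)"
    by (rule sum.mono_neutral_cong_right) (use S in auto)
  also have "\<dots> = (\<Prod>v\<in>S - P. 1 - 1) * g"
    using prod_one_minus_expand[of "S - P" "\<lambda>_. 1 :: rat"] S by (simp add: sum_distrib_right)
  also have "\<dots> = 0"
  proof (cases "S \<subseteq> P")
    case True
    then show ?thesis using f by (simp add: g_def Int_absorb2)
  next
    case False
    then have "S - P \<noteq> {}" by blast
    then show ?thesis using S by (auto simp: card_gt_0_iff)
  qed
  finally show ?thesis .
qed

lemma alternating_ehrhart_series:
  fixes G :: "('v::finite, 'w::finite) bigraph"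
  assumes S: "S \<noteq> {}" "S \<subseteq> Domain (edges G)" "card (edges G `` S) \<le> card S"
  shows "(\<Sum>J\<in>Pow S. (- 1) ^ card J *
     ((1 - fps_X) ^ card (S - J) * ehrhart_series (root_polytope (delete_left G J)))) = 0"
proof (rule fps_ext)
  fix n
  let ?D = "Domain (edges G)"
  define L where "L a T = (of_nat (fibre_count (edges G) (\<lambda>v. a v - of_bool (v \<in> T))) :: rat)" for a T
  have coeff: "fps_nth ((1 - fps_X) ^ card (S - J) * ehrhart_series (root_polytope (delete_left G J))) n =
     (\<Sum>T\<in>Pow (S - J). \<Sum>a\<in>compositions n ?D.
       if {v. a v \<noteq> 0} \<inter> J = {} \<and> T \<subseteq> {v. a v \<noteq> 0} then (- 1) ^ card T * L a T else 0)"
    if J: "J \<subseteq> S" for J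
  proof -
    let ?h = "ehrhart_series (root_polytope (delete_left G J))"
    have "(1 - fps_X) ^ card (S - J) = (\<Sum>T\<in>Pow (S - J). (- 1) ^ card T * fps_X ^ card T :: rat fps)"
      using prod_one_minus_expand[of "S - J" "\<lambda>_. fps_X :: rat fps"] by simp
    then have "fps_nth ((1 - fps_X) ^ card (S - J) * ?h) n =
      (\<Sum>T\<in>Pow (S - J). fps_nth ((- 1) ^ card T * (fps_X ^ card T * ?h)) n)"
      by (simp add: sum_distrib_right fps_sum_nth mult.assoc)
    also have "\<dots> = (\<Sum>T\<in>Pow (S - J). (- 1) ^ card T * fps_nth (fps_X ^ card T * ?h) n)"
    proof (intro sum.cong refl)
      fix T
      have "((- 1) ^ card T :: rat fps) = fps_const ((- 1) ^ card T)"
        by (metis fps_const_1_eq_1 fps_const_neg fps_const_power)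
      then show "fps_nth ((- 1) ^ card T * (fps_X ^ card T * ?h)) n =
          (- 1) ^ card T * fps_nth (fps_X ^ card T * ?h) n"
        by (simp only: fps_mult_left_const_nth)
    qed
    also have "\<dots> = (\<Sum>T\<in>Pow (S - J). (- 1) ^ card T *
      (\<Sum>a | a \<in> compositions n (?D - J) \<and> T \<subseteq> {v. a v \<noteq> 0}. L a T))"
    proof (intro sum.cong refl arg_cong[where f = "\<lambda>s. _ * s"])
      fix T assume "T \<in> Pow (S - J)"
      then have T: "T \<subseteq> ?D - J" using S(2) by blast
      have "fps_nth (fps_X ^ card T * ?h) n = (if n < card T then 0 else
          \<Sum>a\<in>compositions (n - card T) (?D - J). of_nat (fibre_count (edges G) a))"
        by (simp add: fps_X_power_mult_nth ehrhart_series_nth card_lattice_pairs_delete_left)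
      also have "\<dots> = (\<Sum>a | a \<in> compositions n (?D - J) \<and> T \<subseteq> {v. a v \<noteq> 0}. L a T)"
        unfolding L_def by (rule sum_compositions_shift[OF T])
      finally show "fps_nth (fps_X ^ card T * ?h) n =
        (\<Sum>a | a \<in> compositions n (?D - J) \<and> T \<subseteq> {v. a v \<noteq> 0}. L a T)" .
    qed
    also have "\<dots> = (\<Sum>T\<in>Pow (S - J). \<Sum>a\<in>compositions n ?D.
       if {v. a v \<noteq> 0} \<inter> J = {} \<and> T \<subseteq> {v. a v \<noteq> 0} then (- 1) ^ card T * L a T else 0)"
    proof (intro sum.cong refl)
      fix T
      have "{a. a \<in> compositions n (?D - J) \<and> T \<subseteq> {v. a v \<noteq> 0}} =
        {a \<in> compositions n ?D. {v. a v \<noteq> 0} \<inter> J = {} \<and> T \<subseteq> {v. a v \<noteq> 0}}"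
        unfolding compositions_def by blast
      then show "(- 1) ^ card T * (\<Sum>a | a \<in> compositions n (?D - J) \<and> T \<subseteq> {v. a v \<noteq> 0}. L a T) =
        (\<Sum>a\<in>compositions n ?D. if {v. a v \<noteq> 0} \<inter> J = {} \<and> T \<subseteq> {v. a v \<noteq> 0}
          then (- 1) ^ card T * L a T else 0)"
        by (simp only: sum_distrib_left sum.inter_filter[OF finite_compositions])
          (intro sum.cong refl, simp)
    qed
    finally show ?thesis .
  qed
  have "fps_nth (\<Sum>J\<in>Pow S. (- 1) ^ card J *
      ((1 - fps_X) ^ card (S - J) * ehrhart_series (root_polytope (delete_left G J)))) n =
    (\<Sum>J\<in>Pow S. (- 1) ^ card J *
      fps_nth ((1 - fps_X) ^ card (S - J) * ehrhart_series (root_polytope (delete_left G J))) n)"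
    unfolding fps_sum_nth
  proof (intro sum.cong refl)
    fix J :: "'v set"
    have "((- 1) ^ card J :: rat fps) = fps_const ((- 1) ^ card J)"
      by (metis fps_const_1_eq_1 fps_const_neg fps_const_power)
    then show "fps_nth ((- 1) ^ card J *
      ((1 - fps_X) ^ card (S - J) * ehrhart_series (root_polytope (delete_left G J)))) n = (- 1) ^ card J *
      fps_nth ((1 - fps_X) ^ card (S - J) * ehrhart_series (root_polytope (delete_left G J))) n"
      by (simp only: fps_mult_left_const_nth)
  qed
  also have "\<dots> = (\<Sum>J\<in>Pow S. \<Sum>T\<in>Pow (S - J). \<Sum>a\<in>compositions n ?D.
     if {v. a v \<noteq> 0} \<inter> J = {} \<and> T \<subseteq> {v. a v \<noteq> 0} then (- 1) ^ card J * ((- 1) ^ card T * L a T) else 0)"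
  proof (intro sum.cong[OF refl])
    fix J assume "J \<in> Pow S"
    then have J: "J \<subseteq> S" by (rule PowD)
    show "(- 1) ^ card J * fps_nth ((1 - fps_X) ^ card (S - J) * ehrhart_series (root_polytope (delete_left G J))) n =
      (\<Sum>T\<in>Pow (S - J). \<Sum>a\<in>compositions n ?D.
     if {v. a v \<noteq> 0} \<inter> J = {} \<and> T \<subseteq> {v. a v \<noteq> 0} then (- 1) ^ card J * ((- 1) ^ card T * L a T) else 0)"
      unfolding coeff[OF J] sum_distrib_left by (intro sum.cong refl) simp
  qed
  also have "\<dots> = (\<Sum>a\<in>compositions n ?D. \<Sum>J\<in>Pow S. \<Sum>T\<in>Pow (S - J).
     if {v. a v \<noteq> 0} \<inter> J = {} \<and> T \<subseteq> {v. a v \<noteq> 0} then (- 1) ^ card J * ((- 1) ^ card T * L a T) else 0)"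
    by (subst sum.swap, subst (2) sum.swap) (rule refl)
  also have "\<dots> = 0"
  proof (rule sum.neutral, rule ballI, rule signed_pair_sum_eq_0)
    fix a assume "S \<subseteq> {v. a v \<noteq> (0::nat)}"
    then have "of_int (\<Sum>T\<in>Pow S. (- 1) ^ card T *
        int (fibre_count (edges G) (\<lambda>v. a v - of_bool (v \<in> T)))) = (0 :: rat)"
      using alternating_fibre_count[OF S(1,3)] by (simp only: of_int_0)
    then show "(\<Sum>T\<in>Pow S. (- 1) ^ card T * L a T) = 0" by (simp add: L_def)
  qed simp
  finally show "fps_nth (\<Sum>J\<in>Pow S. (- 1) ^ card J *
      ((1 - fps_X) ^ card (S - J) * ehrhart_series (root_polytope (delete_left G J)))) n = fps_nth 0 n"
    by simp
qed

section \<open>Interior polynomials\<close>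

theorem theorem1p1:
  fixes G :: "('v::finite, 'w::finite) bigraph" and S :: "'v set"
  assumes "bipartite_graph G"
    and "non_expanding G S"
  shows "(\<Sum>J\<in>Pow S. (- 1) ^ card J * interior_polynomial (delete_left G J)) = 0"
proof -
  have E: "edges G \<subseteq> left G \<times> right G" using assms(1) by (simp add: bipartite_graph_def)
  have SL: "S \<subseteq> left G" and pos: "0 < card (nbrs_set G S)" and le: "card (nbrs_set G S) \<le> card S"
    and niso: "\<forall>v\<in>S. \<not> isolated_left G v"
    using assms(2) by (simp_all add: non_expanding_def)
  have N: "nbrs_set G S = edges G `` S"
    using E by (auto simp: nbrs_set_def nbrs_def)
  have dom: "S \<subseteq> Domain (edges G)"
  proof
    fix v assume v: "v \<in> S"
    then have "nbrs G v \<noteq> {}" using niso SL by (auto simp: isolated_left_def)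
    then show "v \<in> Domain (edges G)" by (auto simp: nbrs_def)
  qed
  have ne: "S \<noteq> {}" using pos by (auto simp: nbrs_set_def)
  have "nbrs_set G S \<subseteq> right G" by (auto simp: nbrs_set_def nbrs_def)
  then have W: "card (right G) > 0"
    using pos card_mono[of "right G" "nbrs_set G S"] by simp
  \<comment> \<open>The right colour class is nonempty, so the subtraction of \<open>1\<close> in the exponents is never
    truncated, and \<open>(1 - x)\<^sup>k\<close> is a common factor.\<close>
  define k where "k = card (left G) - card S + card (right G) - 1"
  have exponent: "card (left (delete_left G J)) + card (right (delete_left G J)) - 1 = k + card (S - J)"
    if J: "J \<subseteq> S" for J
  proof -
    have "card (left G - J) = card (left G) - card J" "card (S - J) = card S - card J"
      using J SL by (auto intro!: card_Diff_subset)
    moreover have "card J \<le> card S" "card S \<le> card (left G)"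
      using J SL by (auto intro!: card_mono)
    ultimately show ?thesis using W by (simp add: delete_left_def k_def)
  qed
  have "(\<Sum>J\<in>Pow S. (- 1) ^ card J * interior_polynomial (delete_left G J)) =
    (\<Sum>J\<in>Pow S. (1 - fps_X) ^ k * ((- 1) ^ card J *
     ((1 - fps_X) ^ card (S - J) * ehrhart_series (root_polytope (delete_left G J)))))"
  proof (rule sum.cong[OF refl])
    fix J assume "J \<in> Pow S"
    then have "interior_polynomial (delete_left G J) = (1 - fps_X) ^ k *
        ((1 - fps_X) ^ card (S - J) * ehrhart_series (root_polytope (delete_left G J)))"
      by (simp only: interior_polynomial_def exponent[OF PowD] power_add mult.assoc)
    then show "(- 1) ^ card J * interior_polynomial (delete_left G J) = (1 - fps_X) ^ k * ((- 1) ^ card J *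
     ((1 - fps_X) ^ card (S - J) * ehrhart_series (root_polytope (delete_left G J))))"
      by (simp only: mult.left_commute)
  qed
  also have "\<dots> = (1 - fps_X) ^ k * 0"
    unfolding sum_distrib_left[symmetric]
    using alternating_ehrhart_series[OF ne dom le[unfolded N]] by simp
  finally show ?thesis by simp
qed

end
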